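(* Let $n\ge 3$ and let $D\subset\,]0,1[$ be the set of all $s\in\,]0,1[$ that are zeros of some $(n+2)$-dimensional Legendre polynomial of even degree. If $s\in D$, then a sequence $\{u_j\}_{j\ge1}$ of points of $S^{n-1}$ need not be uniformly distributed on $S^{n-1}$ even if $$\lim_{N\to\infty}\frac1N\sum_{j=1}^N\chi_{C_s(u)}(u_j)=P(C_s(u))$$ holds for every spherical cap $C_s(u)$, $u\in S^{n-1}$. That is, for every $s\in D$ there exists a sequence $\{u_j\}$ in $S^{n-1}$ which satisfies $\lim_{N\to\infty}\frac1N\sum_{j=1}^N\chi_{C_s(u)}(u_j)=P(C_s(u))$ for every $u\in S^{n-1}$ but is not uniformly distributed on $S^{n-1}$.
   Context: $S^{n-1}$ is the unit sphere of $\mathbb{R}^n$, $u\cdot v$ is the usual scalar product, and $P$ is the normalized $(n-1)$-dimensional Hausdorff measure on $S^{n-1}$ (the rotation-invariant Borel probability measure). For $u\in S^{n-1}$ and $s\in\,]0,1[$, $C_s(u)=\{v\in S^{n-1}: u\cdot v\ge s\}$. $\chi_A$ denotes the indicator function of $A$. A sequence $\{u_j\}$ in $S^{n-1}$ is uniformly distributed on $S^{n-1}$ if $\lim_{N\to\infty}\frac1N\sum_{j=1}^N\chi_A(u_j)=P(A)$ for every Borel set $A\subset S^{n-1}$ with $P(\partial A)=0$, where $\partial A$ is the boundary of $A$ relative to $S^{n-1}$. For an integer $m\ge 2$, the $m$-dimensional Legendre polynomial of degree $k\ge 0$ is the polynomial of degree $k$ (unique up to a nonzero constant factor, usually normalized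 to take the value $1$ at $1$) that is orthogonal to all polynomials of smaller degree on $[-1,1]$ with respect to the weight $(1-t^2)^{(m-3)/2}$. For $m=n+2$ the weight is $(1-t^2)^{(n-1)/2}$, and the polynomial is proportional to the Gegenbauer polynomial $C_k^{(n/2)}$. *)

theory Defs
  imports "HOL-Analysis.Analysis" "HOL-Computational_Algebra.Polynomial"
begin

text \<open>
  The empty set has to contribute 0 to a covering sum also for \<open>d = 0\<close>, where \<open>0 ^ 0 = 1\<close>; and
  \<open>bounded\<close> is required because \<open>diameter\<close> is a meaningless real number on unbounded sets.
\<close>

definition hausdorff_premeasure :: "nat \<Rightarrow> real \<Rightarrow> 'a::metric_space set \<Rightarrow> ennreal" where
  "hausdorff_premeasure d \<delta> A =
     (INF U \<in> {U :: nat \<Rightarrow> 'a set. A \<subseteq> (\<Union>i. U i) \<and> (\<forall>i. bounded (U i) \<and> diameter (U i) \<le> \<delta>)}.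
        (\<Sum>i. if U i = {} then 0 else ennreal (diameter (U i) ^ d)))"

definition hausdorff_outer_measure :: "nat \<Rightarrow> 'a::metric_space set \<Rightarrow> ennreal" where
  "hausdorff_outer_measure d A = (SUP \<delta> \<in> {0<..}. hausdorff_premeasure d \<delta> A)"

text \<open>
  No dimensional constant is included (it would cancel in \<open>sphere_prob\<close> below).
\<close>

definition hausdorff_measure :: "nat \<Rightarrow> 'a::metric_space measure" where
  "hausdorff_measure d = measure_of UNIV (sets borel) (hausdorff_outer_measure d)"

text \<open>
  As a measure on the Borel sets of the whole space; since the sphere is closed, the Borel subsets
  of the sphere are exactly the Borel sets of the space that are contained in it.
\<close>

definition sphere_prob :: "'a::euclidean_space measure" where
  "sphere_prob = uniform_measure (hausdorff_measure (DIM('a) - 1)) (sphere 0 1)"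

definition spherical_cap :: "real \<Rightarrow> 'a::euclidean_space \<Rightarrow> 'a set" where
  "spherical_cap s u = {v \<in> sphere 0 1. s \<le> u \<bullet> v}"

definition frequencies_converge :: "(nat \<Rightarrow> 'a::euclidean_space) \<Rightarrow> 'a set \<Rightarrow> bool" where
  "frequencies_converge u A \<longleftrightarrow>
     (\<lambda>N. 1 / real N * (\<Sum>j=1..N. indicator A (u j))) \<longlonglongrightarrow> measure sphere_prob A"

text \<open>Sequences are indexed from 1; the term with index 0 is irrelevant.\<close>

definition uniformly_distributed :: "(nat \<Rightarrow> 'a::euclidean_space) \<Rightarrow> bool" where
  "uniformly_distributed u \<longleftrightarrow>
     (\<forall>A. A \<in> sets borel \<longrightarrow> A \<subseteq> sphere 0 1 \<longrightarrow>
          measure sphere_prob (top_of_set (sphere 0 1) frontier_of A) = 0 \<longrightarrow>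
          frequencies_converge u A)"

text \<open>
  Intended for \<open>m \<ge> 2\<close>. The polynomial is determined up to a nonzero constant factor, which does
  not affect its zeros, so no normalization is imposed.
\<close>

definition legendre_poly :: "nat \<Rightarrow> nat \<Rightarrow> real poly \<Rightarrow> bool" where
  "legendre_poly m k p \<longleftrightarrow> p \<noteq> 0 \<and> degree p = k \<and>
     (\<forall>q. degree q < k \<longrightarrow>
        (LBINT t:{-1..1}. poly p t * poly q t * (1 - t\<^sup>2) powr ((real m - 3) / 2)) = 0)"

definition even_legendre_zeros :: "nat \<Rightarrow> real set" where
  "even_legendre_zeros m =
     {s \<in> {0<..<1}. \<exists>k p. even k \<and> legendre_poly m k p \<and> poly p s = 0}"

end

theory Submission
  imports Defs "HOL-Probability.Probability_Measure" "HOL-Real_Asymp.Real_Asymp"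
begin

text \<open>
  The reason for the failure at a zero \<open>s\<close> is a spherical harmonic that no cap \<open>C\<^sub>s(u)\<close> can see. Let
  \<open>p\<close> be a Legendre polynomial of dimension \<open>n + 2\<close> and degree \<open>K\<close> with \<open>p(s) = 0\<close>, let \<open>e1\<close>, \<open>e2\<close>
  be orthonormal, and let \<open>h(x) = Re ((x \<bullet> e1 + \<i> (x \<bullet> e2)) ^ (K + 1))\<close>, a homogeneous harmonic
  polynomial. By the Funk-Hecke formula the integral of \<open>g(x \<bullet> u) h(x)\<close> over the sphere is \<open>h(u)\<close>
  times a number that depends on \<open>g\<close> only, and this number is a fixed multiple of the integral of
  \<open>g'(t) p(t) (1 - t\<^sup>2) powr ((n - 1) / 2)\<close> over \<open>[-1,1]\<close>. If \<open>g\<close> is the indicator of \<open>[s,1]\<close>, then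
  \<open>g'\<close> is the point mass at \<open>s\<close>, and the number is \<open>0\<close> because \<open>p(s) = 0\<close>
  (\<open>integral_cap_plane_harmonic_eq_0\<close>). Hence the probability measure with density \<open>1 + h\<close> with
  respect to \<open>P\<close> gives every cap \<open>C\<^sub>s(u)\<close> the mass \<open>P(C\<^sub>s(u))\<close>, although it differs from \<open>P\<close>, and it
  suffices to find a sequence that is distributed according to it.

  The Funk-Hecke formula is derived from rotation invariance alone. The moments \<open>\<integral> (x \<bullet> v) ^ m\<close>
  equal \<open>c\<^sub>m |v| ^ m\<close>. For even \<open>m\<close> both sides are polynomials in \<open>v\<close>, so the identity extends to
  complex vectors. For \<open>v = u + \<beta> \<zeta>\<close> with the isotropic vector \<open>\<zeta> = e1 + \<i> e2\<close> the form \<open>v \<bullet> v\<close>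
  collapses to \<open>1 + 2 \<beta> (u \<bullet> \<zeta>)\<close>, and a comparison of the coefficients of \<open>\<beta> ^ k\<close> gives
  \<open>\<integral> (x \<bullet> u) ^ a (x \<bullet> \<zeta>) ^ k = \<lambda>\<^sub>a (u \<bullet> \<zeta>) ^ k\<close> (\<open>funk_hecke_monomial\<close>). The \<open>\<lambda>\<^sub>a\<close> satisfy a
  two-step recurrence. The numbers \<open>\<integral> (t ^ a)' p(t) (1 - t\<^sup>2) powr ((n - 1) / 2)\<close> satisfy the same
  recurrence because of the differential equation of \<open>p\<close>, which follows from orthogonality; so both
  sequences are proportional (\<open>funk_hecke_factor_eq_legendre_moment\<close>). This settles polynomials \<open>g\<close>;
  Weierstrass approximation and bump functions concentrating at \<open>s\<close> lead to the indicator.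

  For countably many events there is a sequence whose frequencies converge to the given
  probabilities (\<open>derandomized_law_of_large_numbers\<close>): the points are chosen greedily, so that a
  weighted sum of squared discrepancies grows at most linearly, as it would on average for random
  points; each discrepancy is then of order \<open>sqrt N\<close>. Caps with rational height and center in a
  countable dense set are enough to control all caps \<open>C\<^sub>s(w)\<close>, because circles of latitude are null
  sets. One further event, a superlevel set \<open>{h \<ge> \<delta>}\<close> with null boundary, witnesses that the
  sequence is not uniformly distributed.

  All this presupposes that \<open>P\<close> is a rotation-invariant probability measure
  (\<open>sphere_prob_rotation_invariant\<close>). Hausdorff outer measure is metric, so Borel sets are
  Caratheodory measurable; and the sphere has finite measure by a packing argument and positive
  measure because the cone over a small set is contained in a thin tube.
\<close>

section \<open>Metric outer measures\<close>

text \<open>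
  The properties of Hausdorff outer measure from which Caratheodory's criterion follows.
\<close>

locale metric_outer_measure =
  fixes \<phi> :: "'a::metric_space set \<Rightarrow> ennreal"
  assumes empty: "\<phi> {} = 0"
    and mono: "A \<subseteq> B \<Longrightarrow> \<phi> A \<le> \<phi> B"
    and countably_subadditive: "\<phi> (\<Union>i::nat. U i) \<le> (\<Sum>i. \<phi> (U i))"
    and separated: "0 < \<eta> \<Longrightarrow> (\<And>x y. x \<in> A \<Longrightarrow> y \<in> B \<Longrightarrow> \<eta> \<le> dist x y) \<Longrightarrow> \<phi> A + \<phi> B \<le> \<phi> (A \<union> B)"
begin

lemma subadditive: "\<phi> (A \<union> B) \<le> \<phi> A + \<phi> B"
proof -
  have "\<phi> (\<Union>i. binaryset A B i) \<le> (\<Sum>i. \<phi> (binaryset A B i))"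
    by (rule countably_subadditive)
  then show ?thesis by (simp add: UN_binaryset_eq suminf_binaryset_eq[of \<phi>] empty)
qed

text \<open>
  Consecutive layers around a closed set touch each other, but every second layer is at positive
  distance from the union of the previous ones, so metric additivity applies inductively. The offset
  \<open>c\<close> selects the even or the odd layers.
\<close>

lemma sum_every_second_le:
  fixes R :: "nat \<Rightarrow> 'a set"
  assumes sep: "\<And>i j. i + 2 \<le> j \<Longrightarrow> \<exists>\<eta>>0. \<forall>x\<in>R i. \<forall>y\<in>R j. \<eta> \<le> dist x y"
  shows "(\<Sum>i<n. \<phi> (R (2 * i + c))) \<le> \<phi> (\<Union>i<n. R (2 * i + c))"
proof (induction n)
  case (Suc n)
  have "\<exists>\<eta>>0. \<forall>x\<in>(\<Union>i<n. R (2 * i + c)). \<forall>y\<in>R (2 * n + c). \<eta> \<le> dist x y"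
  proof -
    have "\<forall>i. \<exists>\<eta>>0. i < n \<longrightarrow> (\<forall>x\<in>R (2 * i + c). \<forall>y\<in>R (2 * n + c). \<eta> \<le> dist x y)"
    proof
      fix i
      show "\<exists>\<eta>>0. i < n \<longrightarrow> (\<forall>x\<in>R (2 * i + c). \<forall>y\<in>R (2 * n + c). \<eta> \<le> dist x y)"
        using sep[of "2 * i + c" "2 * n + c"] by (cases "i < n") (auto intro: exI[of _ 1])
    qed
    then obtain \<eta> where \<eta>: "\<And>i. 0 < \<eta> i"
        "\<And>i x y. i < n \<Longrightarrow> x \<in> R (2 * i + c) \<Longrightarrow> y \<in> R (2 * n + c) \<Longrightarrow> \<eta> i \<le> dist x y"
      by metis
    have "0 < Min (insert 1 (\<eta> ` {..<n}))" using \<eta>(1) by (subst Min_gr_iff) auto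
    moreover have "Min (insert 1 (\<eta> ` {..<n})) \<le> dist x y"
      if "i < n" "x \<in> R (2 * i + c)" "y \<in> R (2 * n + c)" for i x y
      using \<eta>(2)[OF that] that(1) by (intro order_trans[OF Min_le]) auto
    ultimately show ?thesis by blast
  qed
  then obtain \<eta> where \<eta>: "\<eta> > 0"
      "\<And>x y. x \<in> (\<Union>i<n. R (2 * i + c)) \<Longrightarrow> y \<in> R (2 * n + c) \<Longrightarrow> \<eta> \<le> dist x y"
    by blast
  have "(\<Sum>i<Suc n. \<phi> (R (2 * i + c))) \<le> \<phi> (\<Union>i<n. R (2 * i + c)) + \<phi> (R (2 * n + c))"
    using Suc by (simp add: add_mono)
  also have "\<dots> \<le> \<phi> ((\<Union>i<n. R (2 * i + c)) \<union> R (2 * n + c))"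
    using \<eta> by (rule separated)
  finally show ?case by (simp add: lessThan_Suc Un_commute)
qed simp

lemma sum_separated_le:
  fixes R :: "nat \<Rightarrow> 'a set"
  assumes sep: "\<And>i j. i + 2 \<le> j \<Longrightarrow> \<exists>\<eta>>0. \<forall>x\<in>R i. \<forall>y\<in>R j. \<eta> \<le> dist x y"
    and sub: "\<And>i. R i \<subseteq> A"
  shows "(\<Sum>i. \<phi> (R i)) \<le> 2 * \<phi> A"
proof (rule suminf_le_const[OF summableI])
  fix n
  have half: "(\<Sum>i<n. \<phi> (R (2 * i + c))) \<le> \<phi> A" for c
  proof -
    have "(\<Sum>i<n. \<phi> (R (2 * i + c))) \<le> \<phi> (\<Union>i<n. R (2 * i + c))"
      by (rule sum_every_second_le) (rule sep)
    also have "\<dots> \<le> \<phi> A" using sub by (intro mono) blast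
    finally show ?thesis .
  qed
  have "(\<Sum>i<n. \<phi> (R i)) \<le> (\<Sum>i<2*n. \<phi> (R i))"
    by (intro sum_mono2) auto
  also have "\<dots> = (\<Sum>i<n. \<phi> (R (2 * i + 0))) + (\<Sum>i<n. \<phi> (R (2 * i + 1)))"
    by (induction n) (simp_all add: algebra_simps)
  also have "\<dots> \<le> 2 * \<phi> A"
    using half[of 0] half[of 1] by (metis add_mono mult_2)
  finally show "(\<Sum>i<n. \<phi> (R i)) \<le> 2 * \<phi> A" .
qed

text \<open>
  Caratheodory's criterion. Cut \<open>A - F\<close> into the layers \<open>R k\<close> according to the distance from \<open>F\<close>.
  The part \<open>S k\<close> at distance at least \<open>1 / (k + 1)\<close> from \<open>F\<close> is separated from \<open>A \<inter> F\<close>; what remains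
  near \<open>F\<close> is the union of the layers from \<open>k\<close> on, and its measure tends to 0, because the sum over
  all layers is at most \<open>2 * \<phi> A\<close>, which may be assumed finite.
\<close>

lemma closed_caratheodory_measurable:
  assumes F: "closed F"
  shows "\<phi> (A \<inter> F) + \<phi> (A - F) = \<phi> A"
proof (rule antisym)
  have "A = (A \<inter> F) \<union> (A - F)" by auto
  then show "\<phi> A \<le> \<phi> (A \<inter> F) + \<phi> (A - F)" using subadditive by metis
  show "\<phi> (A \<inter> F) + \<phi> (A - F) \<le> \<phi> A"
  proof (cases "F = {} \<or> \<phi> A = top")
    case True then show ?thesis by (auto simp: empty)
  next
    case False
    then have ne: "F \<noteq> {}" and fin: "\<phi> A < top" by (auto simp: less_top)
    define S where "S k = {x\<in>A. 1 / real (k + 1) \<le> infdist x F}" for k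
    define R where "R k = {x\<in>A. 1 / real (k + 2) \<le> infdist x F \<and> infdist x F < 1 / real (k + 1)}" for k
    have "\<exists>\<eta>>0. \<forall>x\<in>R i. \<forall>y\<in>R j. \<eta> \<le> dist x y" if "i + 2 \<le> j" for i j
    proof (intro exI conjI ballI)
      show "1 / real (i + 2) - 1 / real (i + 3) > 0" by (simp add: frac_less2)
      fix x y assume "x \<in> R i" "y \<in> R j"
      moreover have "1 / real (j + 1) \<le> 1 / real (i + 3)" using that by (intro divide_left_mono) auto
      moreover have "infdist x F \<le> infdist y F + dist x y" by (rule infdist_triangle)
      ultimately show "1 / real (i + 2) - 1 / real (i + 3) \<le> dist x y" by (auto simp: R_def)
    qed
    then have "(\<Sum>i. \<phi> (R i)) \<le> 2 * \<phi> A"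
      by (rule sum_separated_le) (auto simp: R_def)
    also have "\<dots> < top" using fin by (simp add: ennreal_mult_less_top)
    finally have finR: "(\<Sum>i. \<phi> (R i)) < top" .
    have cover: "\<phi> (A - F) \<le> \<phi> (S k) + (\<Sum>i. \<phi> (R (i + k)))" for k
    proof -
      have "A - F \<subseteq> S k \<union> (\<Union>i. R (i + k))"
      proof
        fix x assume x: "x \<in> A - F"
        then have pos: "infdist x F > 0"
          using F ne in_closed_iff_infdist_zero[of F x] infdist_nonneg[of x F] by auto
        then obtain N where N: "1 / real (Suc N) < infdist x F"
          using nat_approx_posE by (metis One_nat_def inverse_eq_divide)
        define j where "j = (LEAST j. 1 / real (j + 1) \<le> infdist x F)"
        have j: "1 / real (j + 1) \<le> infdist x F"
          unfolding j_def by (rule LeastI[of _ N]) (use N in auto)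
        show "x \<in> S k \<union> (\<Union>i. R (i + k))"
        proof (cases "j \<le> k")
          case True
          then have "1 / real (k + 1) \<le> 1 / real (j + 1)" by (intro divide_left_mono) auto
          then show ?thesis using j x by (auto simp: S_def)
        next
          case False
          then have "\<not> 1 / real (j - 1 + 1) \<le> infdist x F"
            unfolding j_def by (intro not_less_Least) auto
          then have "x \<in> R ((j - 1 - k) + k)" using j x False by (auto simp: R_def of_nat_diff)
          then show ?thesis by blast
        qed
      qed
      then have "\<phi> (A - F) \<le> \<phi> (S k \<union> (\<Union>i. R (i + k)))" by (rule mono)
      also have "\<dots> \<le> \<phi> (S k) + \<phi> (\<Union>i. R (i + k))" by (rule subadditive)
      also have "\<dots> \<le> \<phi> (S k) + (\<Sum>i. \<phi> (R (i + k)))"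
        by (intro add_left_mono countably_subadditive)
      finally show ?thesis .
    qed
    have S: "\<phi> (A \<inter> F) + \<phi> (S k) \<le> \<phi> A" for k
    proof -
      have "1 / real (k + 1) \<le> dist x y" if "x \<in> A \<inter> F" "y \<in> S k" for x y
        using infdist_le[of x F y] that by (auto simp: S_def dist_commute)
      then have "\<phi> (A \<inter> F) + \<phi> (S k) \<le> \<phi> (A \<inter> F \<union> S k)" by (intro separated[of "1 / real (k + 1)"]) auto
      also have "\<dots> \<le> \<phi> A" by (intro mono) (auto simp: S_def)
      finally show ?thesis .
    qed
    have bound: "\<phi> (A \<inter> F) + \<phi> (A - F) \<le> \<phi> A + (\<Sum>i. \<phi> (R (i + k)))" for k
    proof -
      have "\<phi> (A \<inter> F) + \<phi> (A - F) \<le> \<phi> (A \<inter> F) + (\<phi> (S k) + (\<Sum>i. \<phi> (R (i + k))))"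
        by (intro add_left_mono cover)
      also have "\<dots> \<le> \<phi> A + (\<Sum>i. \<phi> (R (i + k)))"
        unfolding add.assoc[symmetric] by (intro add_right_mono S)
      finally show ?thesis .
    qed
    have "(\<lambda>k. \<Sum>i. \<phi> (R (i + k))) \<longlonglongrightarrow> 0"
    proof -
      have "(\<lambda>k. (\<Sum>i. \<phi> (R i)) - (\<Sum>i<k. \<phi> (R i))) \<longlonglongrightarrow> (\<Sum>i. \<phi> (R i)) - (\<Sum>i. \<phi> (R i))"
        using finR by (intro tendsto_diff_ennreal tendsto_const summable_LIMSEQ summableI) auto
      moreover have "(\<Sum>i. \<phi> (R i)) - (\<Sum>i<k. \<phi> (R i)) = (\<Sum>i. \<phi> (R (i + k)))" for k
      proof -
        have "(\<Sum>i. \<phi> (R i)) = (\<Sum>i<k. \<phi> (R i)) + (\<Sum>i. \<phi> (R (i + k)))"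
          using suminf_offset[of "\<lambda>i. \<phi> (R i)" k] by (simp add: summableI add.commute)
        then show ?thesis using finR by (auto simp: less_top)
      qed
      ultimately show ?thesis using finR by simp
    qed
    then have "(\<lambda>k. \<phi> A + (\<Sum>i. \<phi> (R (i + k)))) \<longlonglongrightarrow> \<phi> A + 0" by (intro tendsto_add tendsto_const)
    then show ?thesis using bound by (intro LIMSEQ_le_const[of _ "\<phi> A"]) auto
  qed
qed

theorem measure_space_borel: "measure_space UNIV (sets borel) \<phi>"
proof -
  let ?L = "lambda_system UNIV UNIV \<phi>"
  interpret U: sigma_algebra UNIV "UNIV :: 'a set set"
    using sigma_algebra_Pow[of "UNIV :: 'a set"] by simp
  have "outer_measure_space UNIV \<phi>"
    unfolding outer_measure_space_def positive_def increasing_def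
      countably_subadditive_def
    using empty mono countably_subadditive by auto
  then have L: "measure_space UNIV ?L \<phi>" by (rule U.caratheodory_lemma)
  then have sig: "sigma_algebra UNIV ?L" by (simp add: measure_space_def)
  have "Collect closed \<subseteq> ?L"
    using closed_caratheodory_measurable by (auto simp: U.lambda_system_eq)
  then have "sigma_sets UNIV (Collect closed) \<subseteq> ?L"
    by (rule sigma_algebra.sigma_sets_subset[OF sig])
  moreover have "sets (borel :: 'a measure) = sigma_sets UNIV (Collect closed)"
    unfolding borel_eq_closed by (rule sets_measure_of) auto
  ultimately have "sets borel \<subseteq> ?L" by simp
  then show ?thesis
    using L sets.sigma_algebra_axioms[of "borel :: 'a measure"]
    unfolding measure_space_def by (auto simp: positive_def countably_additive_def)
qed

end

section \<open>Hausdorff measure\<close>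

definition diameter_power :: "nat \<Rightarrow> 'a::metric_space set \<Rightarrow> ennreal" where
  "diameter_power d B = (if B = {} then 0 else ennreal (diameter B ^ d))"

definition diameter_sum :: "nat \<Rightarrow> (nat \<Rightarrow> 'a::metric_space set) \<Rightarrow> ennreal" where
  "diameter_sum d U = (\<Sum>i. diameter_power d (U i))"

definition fine_cover :: "real \<Rightarrow> 'a::metric_space set \<Rightarrow> (nat \<Rightarrow> 'a set) \<Rightarrow> bool" where
  "fine_cover \<delta> A U \<longleftrightarrow> A \<subseteq> (\<Union>i. U i) \<and> (\<forall>i. bounded (U i) \<and> diameter (U i) \<le> \<delta>)"

lemma hausdorff_premeasure_eq_INF:
  "hausdorff_premeasure d \<delta> A = (INF U \<in> Collect (fine_cover \<delta> A). diameter_sum d U)"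
  unfolding hausdorff_premeasure_def diameter_sum_def diameter_power_def fine_cover_def ..

lemma hausdorff_premeasure_le: "fine_cover \<delta> A U \<Longrightarrow> hausdorff_premeasure d \<delta> A \<le> diameter_sum d U"
  unfolding hausdorff_premeasure_eq_INF by (rule INF_lower) simp

lemma hausdorff_premeasure_less_iff:
  "hausdorff_premeasure d \<delta> A < b \<longleftrightarrow> (\<exists>U. fine_cover \<delta> A U \<and> diameter_sum d U < b)"
  unfolding hausdorff_premeasure_eq_INF by (simp add: INF_less_iff)

lemma fine_cover_mono: "fine_cover \<delta> B U \<Longrightarrow> A \<subseteq> B \<Longrightarrow> \<delta> \<le> \<epsilon> \<Longrightarrow> fine_cover \<epsilon> A U"
  unfolding fine_cover_def by (meson order_trans)

lemma hausdorff_premeasure_mono: "A \<subseteq> B \<Longrightarrow> hausdorff_premeasure d \<delta> A \<le> hausdorff_premeasure d \<delta> B"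
  unfolding hausdorff_premeasure_eq_INF
  by (rule INF_superset_mono) (auto intro: fine_cover_mono)

lemma hausdorff_premeasure_antimono:
  "\<delta> \<le> \<epsilon> \<Longrightarrow> hausdorff_premeasure d \<epsilon> A \<le> hausdorff_premeasure d \<delta> A"
  unfolding hausdorff_premeasure_eq_INF
  by (rule INF_superset_mono) (auto intro: fine_cover_mono)

lemma hausdorff_premeasure_le_outer: "0 < \<delta> \<Longrightarrow> hausdorff_premeasure d \<delta> A \<le> hausdorff_outer_measure d A"
  unfolding hausdorff_outer_measure_def by (rule SUP_upper) simp

lemma hausdorff_premeasure_countably_subadditive:
  "hausdorff_premeasure d \<delta> (\<Union>i::nat. A i) \<le> (\<Sum>i. hausdorff_premeasure d \<delta> (A i))"
proof (rule ennreal_le_epsilon)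
  let ?p = "hausdorff_premeasure d \<delta>"
  fix e :: real assume e: "0 < e" and fin: "(\<Sum>i. ?p (A i)) < top"
  have "?p (A i) < ?p (A i) + e * (1/2)^Suc i" for i
    using fin e by (auto simp: less_top dest!: ennreal_suminf_lessD)
  then have "\<forall>i. \<exists>U. fine_cover \<delta> (A i) U \<and> diameter_sum d U < ?p (A i) + e * (1/2)^Suc i"
    using hausdorff_premeasure_less_iff by blast
  then obtain U where U: "\<And>i. fine_cover \<delta> (A i) (U i)"
      "\<And>i. diameter_sum d (U i) < ?p (A i) + e * (1/2)^Suc i"
    by metis
  define V where "V = case_prod U \<circ> prod_decode"
  have "x \<in> (\<Union>j. V j)" if x: "x \<in> A i" for x i
  proof -
    obtain j where "x \<in> U i j" using x U(1)[of i] by (auto simp: fine_cover_def)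
    then have "x \<in> V (prod_encode (i, j))" by (simp add: V_def)
    then show ?thesis by blast
  qed
  then have "fine_cover \<delta> (\<Union>i. A i) V"
    using U(1) by (auto simp: fine_cover_def V_def split_beta)
  then have "?p (\<Union>i. A i) \<le> diameter_sum d V" by (rule hausdorff_premeasure_le)
  also have "\<dots> = (\<Sum>i. diameter_sum d (U i))"
    unfolding diameter_sum_def V_def
    by (subst suminf_ennreal_2dimen[of _ "\<lambda>(i, j). diameter_power d (U i j)", symmetric])
      (auto simp: comp_def split_beta)
  also have "\<dots> \<le> (\<Sum>i. ?p (A i) + e * (1/2) ^ Suc i)"
    using U(2) by (intro suminf_le allI summableI less_imp_le) auto
  also have "\<dots> = (\<Sum>i. ?p (A i)) + (\<Sum>i. ennreal e * ennreal ((1/2) ^ Suc i))"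
    using e by (subst suminf_add[symmetric])
      (auto simp del: ennreal_suminf_cmult simp add: ennreal_mult[symmetric])
  also have "\<dots> = (\<Sum>i. ?p (A i)) + e"
    unfolding ennreal_suminf_cmult
    by (subst suminf_ennreal_eq[OF zero_le_power power_half_series]) auto
  finally show "?p (\<Union>i. A i) \<le> (\<Sum>i. ?p (A i)) + e" .
qed

text \<open>
  A covering set of diameter below \<open>\<eta>\<close> cannot meet both parts, so a fine cover of the union splits
  into a cover of each.
\<close>

lemma hausdorff_premeasure_separated:
  assumes "\<delta> < \<eta>" and sep: "\<And>x y. x \<in> A \<Longrightarrow> y \<in> B \<Longrightarrow> \<eta> \<le> dist x y"
  shows "hausdorff_premeasure d \<delta> A + hausdorff_premeasure d \<delta> B \<le> hausdorff_premeasure d \<delta> (A \<union> B)"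
  unfolding hausdorff_premeasure_eq_INF[of d \<delta> "A \<union> B"]
proof (rule INF_greatest)
  fix U assume "U \<in> Collect (fine_cover \<delta> (A \<union> B))"
  then have U: "A \<union> B \<subseteq> (\<Union>i. U i)" "\<And>i. bounded (U i)" "\<And>i. diameter (U i) \<le> \<delta>"
    by (auto simp: fine_cover_def)
  define V where "V C i = (if U i \<inter> C = {} then {} else U i)" for C i
  have "0 \<le> \<delta>" using diameter_ge_0[OF U(2)] U(3) order_trans by blast
  then have "fine_cover \<delta> C (V C)" if "C \<subseteq> A \<union> B" for C
    using U that by (fastforce simp: fine_cover_def V_def)
  then have "hausdorff_premeasure d \<delta> A + hausdorff_premeasure d \<delta> B \<le> diameter_sum d (V A) + diameter_sum d (V B)"
    by (intro add_mono hausdorff_premeasure_le) auto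
  also have "\<dots> \<le> diameter_sum d U"
  proof -
    have "U i \<inter> A = {} \<or> U i \<inter> B = {}" for i
    proof (rule ccontr)
      assume "\<not> ?thesis"
      then obtain x y where xy: "x \<in> U i" "x \<in> A" "y \<in> U i" "y \<in> B" by auto
      then have "dist x y \<le> \<delta>" using diameter_bounded_bound[OF U(2)] U(3) order_trans by blast
      then show False using sep[of x y] xy assms(1) by auto
    qed
    then show ?thesis
      unfolding diameter_sum_def suminf_add[OF summableI summableI]
      by (intro suminf_le summableI) (auto simp: V_def diameter_power_def)
  qed
  finally show "hausdorff_premeasure d \<delta> A + hausdorff_premeasure d \<delta> B \<le> diameter_sum d U" .
qed

text \<open>
  The mesh \<open>\<delta>\<close> has to be refined below the distance of the two sets before the premeasures become
  additive; this costs nothing since the premeasures increase as the mesh decreases.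
\<close>

interpretation hausdorff: metric_outer_measure "hausdorff_outer_measure d"
proof
  show "hausdorff_outer_measure d {} = 0"
  proof -
    have "hausdorff_premeasure d \<delta> {} \<le> 0" if "0 < \<delta>" for \<delta>
      using hausdorff_premeasure_le[of \<delta> "{}" "\<lambda>_. {}" d] that
      by (simp add: fine_cover_def diameter_sum_def diameter_power_def)
    then have "hausdorff_outer_measure d {} \<le> 0"
      unfolding hausdorff_outer_measure_def by (intro SUP_least) auto
    then show ?thesis by simp
  qed
  show "hausdorff_outer_measure d A \<le> hausdorff_outer_measure d B" if "A \<subseteq> B" for A B
    unfolding hausdorff_outer_measure_def
    by (intro SUP_mono' hausdorff_premeasure_mono that)
  show "hausdorff_outer_measure d (\<Union>i. U i) \<le> (\<Sum>i. hausdorff_outer_measure d (U i))" for U :: "nat \<Rightarrow> 'a set"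
    unfolding hausdorff_outer_measure_def[of d "\<Union>i. U i"]
  proof (rule SUP_least)
    fix \<delta> :: real assume "\<delta> \<in> {0<..}"
    then show "hausdorff_premeasure d \<delta> (\<Union>i. U i) \<le> (\<Sum>i. hausdorff_outer_measure d (U i))"
      by (intro order_trans[OF hausdorff_premeasure_countably_subadditive] suminf_le summableI allI
            hausdorff_premeasure_le_outer) auto
  qed
  show "hausdorff_outer_measure d A + hausdorff_outer_measure d B \<le> hausdorff_outer_measure d (A \<union> B)"
    if \<eta>: "0 < \<eta>" and sep: "\<And>x y. x \<in> A \<Longrightarrow> y \<in> B \<Longrightarrow> \<eta> \<le> dist x y" for \<eta> and A B :: "'a set"
  proof -
    have "hausdorff_outer_measure d A + hausdorff_outer_measure d B =
        (SUP \<delta>\<in>{0<..}. hausdorff_premeasure d \<delta> A + hausdorff_premeasure d \<delta> B)"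
      unfolding hausdorff_outer_measure_def
    proof (rule SUP_add_directed_ennreal[symmetric])
      fix \<delta> \<epsilon> :: real assume "\<delta> \<in> {0<..}" "\<epsilon> \<in> {0<..}"
      then show "\<exists>k\<in>{0<..}. hausdorff_premeasure d \<delta> A + hausdorff_premeasure d \<epsilon> B
          \<le> hausdorff_premeasure d k A + hausdorff_premeasure d k B"
        by (intro bexI[of _ "min \<delta> \<epsilon>"] add_mono hausdorff_premeasure_antimono) auto
    qed
    also have "\<dots> \<le> hausdorff_outer_measure d (A \<union> B)"
    proof (rule SUP_least)
      fix \<delta> :: real assume "\<delta> \<in> {0<..}"
      define \<epsilon> where "\<epsilon> = min \<delta> (\<eta> / 2)"
      have \<epsilon>: "0 < \<epsilon>" "\<epsilon> \<le> \<delta>" "\<epsilon> < \<eta>" using \<open>\<delta> \<in> {0<..}\<close> \<eta> by (auto simp: \<epsilon>_def)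
      have "hausdorff_premeasure d \<delta> A + hausdorff_premeasure d \<delta> B
          \<le> hausdorff_premeasure d \<epsilon> A + hausdorff_premeasure d \<epsilon> B"
        using \<epsilon> by (intro add_mono hausdorff_premeasure_antimono) auto
      also have "\<dots> \<le> hausdorff_premeasure d \<epsilon> (A \<union> B)"
        using \<epsilon> sep by (intro hausdorff_premeasure_separated)
      also have "\<dots> \<le> hausdorff_outer_measure d (A \<union> B)"
        using \<epsilon> by (intro hausdorff_premeasure_le_outer)
      finally show "hausdorff_premeasure d \<delta> A + hausdorff_premeasure d \<delta> B \<le> hausdorff_outer_measure d (A \<union> B)" .
    qed
    finally show ?thesis .
  qed
qed

lemma sets_hausdorff_measure [simp, measurable_cong]: "sets (hausdorff_measure d) = sets borel"
  unfolding hausdorff_measure_def using sets.sigma_sets_eq[of borel] by (simp add: sets_measure_of)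

lemma space_hausdorff_measure [simp]: "space (hausdorff_measure d) = UNIV"
  unfolding hausdorff_measure_def by (simp add: space_measure_of_conv)

lemma emeasure_hausdorff_measure:
  assumes "A \<in> sets borel"
  shows "emeasure (hausdorff_measure d) A = hausdorff_outer_measure d A"
  unfolding hausdorff_measure_def
  using hausdorff.measure_space_borel[of d] assms
  by (intro emeasure_measure_of_sigma) (auto simp: measure_space_def)

lemma hausdorff_outer_measure_isometry_le:
  assumes iso: "\<And>x y. dist (f x) (f y) = dist x y"
  shows "hausdorff_outer_measure d (f ` A) \<le> hausdorff_outer_measure d A"
proof -
  have diam: "diameter (f ` B) = diameter B" for B
  proof -
    have "case_prod dist ` (f ` B \<times> f ` B) = case_prod dist ` (B \<times> B)"
      by (force simp: iso image_iff)
    then show ?thesis by (simp add: diameter_def)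
  qed
  have "bounded (f ` B)" if B: "bounded B" for B
  proof -
    obtain x e where "\<forall>y\<in>B. dist x y \<le> e" using B by (auto simp: bounded_def)
    then have "\<forall>y\<in>f ` B. dist (f x) y \<le> e" by (auto simp: iso)
    then show ?thesis by (auto simp: bounded_def)
  qed
  then have "hausdorff_premeasure d \<delta> (f ` A) \<le> hausdorff_premeasure d \<delta> A" for \<delta>
    unfolding hausdorff_premeasure_eq_INF[of d \<delta> A]
  proof (intro INF_greatest)
    fix U assume "U \<in> Collect (fine_cover \<delta> A)"
    then have "fine_cover \<delta> (f ` A) (\<lambda>i. f ` U i)"
      using \<open>\<And>B. bounded B \<Longrightarrow> bounded (f ` B)\<close>
      by (simp add: fine_cover_def diam image_UN[symmetric] image_mono)
    then have "hausdorff_premeasure d \<delta> (f ` A) \<le> diameter_sum d (\<lambda>i. f ` U i)"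
      by (rule hausdorff_premeasure_le)
    then show "hausdorff_premeasure d \<delta> (f ` A) \<le> diameter_sum d U"
      by (simp add: diameter_sum_def diameter_power_def[abs_def] diam cong: if_cong)
  qed
  then show ?thesis unfolding hausdorff_outer_measure_def by (intro SUP_mono')
qed

lemma hausdorff_premeasure_le_finite_sum:
  assumes "finite F" "A \<subseteq> (\<Union>x\<in>F. V x)" "0 \<le> \<delta>" "0 \<le> r"
    and V: "\<And>x. x \<in> F \<Longrightarrow> bounded (V x) \<and> diameter (V x) \<le> r" "r \<le> \<delta>"
  shows "hausdorff_premeasure d \<delta> A \<le> ennreal (real (card F) * r ^ d)"
proof -
  obtain e where e: "bij_betw e {0..<card F} F" using assms(1) ex_bij_betw_nat_finite by blast
  define U where "U i = (if i < card F then V (e i) else {})" for i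
  have eF: "e i \<in> F" if "i < card F" for i using e that by (auto simp: bij_betw_def)
  have "A \<subseteq> (\<Union>i. U i)"
  proof
    fix a assume "a \<in> A"
    then obtain x where x: "x \<in> F" "a \<in> V x" using assms(2) by auto
    then obtain i where "i < card F" "x = e i" using e by (fastforce simp: bij_betw_def)
    then have "a \<in> U i" using x by (simp add: U_def)
    then show "a \<in> (\<Union>i. U i)" by blast
  qed
  then have "fine_cover \<delta> A U"
    using V eF assms(3) by (fastforce simp: fine_cover_def U_def)
  then have "hausdorff_premeasure d \<delta> A \<le> diameter_sum d U" by (rule hausdorff_premeasure_le)
  also have "\<dots> = (\<Sum>i<card F. diameter_power d (U i))"
    unfolding diameter_sum_def by (intro suminf_finite) (auto simp: U_def diameter_power_def)
  also have "\<dots> \<le> (\<Sum>i<card F. ennreal (r ^ d))"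
    using V eF by (intro sum_mono) (auto simp: U_def diameter_power_def intro!: ennreal_leI power_mono diameter_ge_0)
  also have "\<dots> = ennreal (real (card F) * r ^ d)"
    using assms(4) by (simp add: ennreal_mult ennreal_of_nat_eq_real_of_nat)
  finally show ?thesis .
qed

section \<open>The Hausdorff measure of the unit sphere\<close>

lemma power_diff_le_linear:
  fixes h :: real assumes "0 \<le> h" "h \<le> 1"
  shows "(1 + h) ^ n - (1 - h) ^ n \<le> 2 * h * (real n * 2 ^ (n - 1))"
proof -
  have "(1 + h) ^ n - (1 - h) ^ n = 2 * h * (\<Sum>i<n. (1 - h) ^ (n - Suc i) * (1 + h) ^ i)"
    unfolding power_diff_sumr2 by simp
  also have "(\<Sum>i<n. (1 - h) ^ (n - Suc i) * (1 + h) ^ i) \<le> (\<Sum>i<n. 2 ^ (n - 1))"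
  proof (rule sum_mono)
    fix i assume i: "i \<in> {..<n}"
    have "(1 - h) ^ (n - Suc i) * (1 + h) ^ i \<le> 1 * 2 ^ i"
      using assms by (intro mult_mono power_le_one power_mono) auto
    also have "\<dots> \<le> 2 ^ (n - 1)" using i by (simp add: power_increasing)
    finally show "(1 - h) ^ (n - Suc i) * (1 + h) ^ i \<le> 2 ^ (n - 1)" .
  qed
  finally show ?thesis using assms by (simp add: mult_left_mono)
qed

text \<open>
  Packing: the balls of radius \<open>\<delta> / 2\<close> around the points are disjoint and lie in the shell of width
  \<open>\<delta>\<close> around the sphere, whose volume is of order \<open>\<delta>\<close>.
\<close>

lemma card_separated_sphere_le:
  fixes F :: "'a::euclidean_space set"
  assumes F: "finite F" "F \<subseteq> sphere 0 1" and sep: "pairwise (\<lambda>x y. \<delta> \<le> dist x y) F"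
    and \<delta>: "0 < \<delta>" "\<delta> \<le> 1"
  shows "real (card F) * \<delta> ^ (DIM('a) - 1) \<le> real DIM('a) * 4 ^ DIM('a)"
proof -
  let ?n = "DIM('a)"
  define h where "h = \<delta> / 2"
  have h: "0 < h" "h < 1" using \<delta> by (auto simp: h_def)
  define \<omega> where "\<omega> = unit_ball_vol (real ?n)"
  have \<omega>: "\<omega> > 0" by (simp add: \<omega>_def)
  have disj: "disjoint_family_on (\<lambda>x. ball x h) F"
  unfolding disjoint_family_on_def
  proof (intro ballI impI)
    fix x y assume "x \<in> F" "y \<in> F" "x \<noteq> y"
    then have "\<delta> \<le> dist x y" using sep by (auto simp: pairwise_def)
    then show "ball x h \<inter> ball y h = {}" by (intro disjoint_ballI) (simp add: h_def)
  qed
  have norm: "1 - h < norm y \<and> norm y < 1 + h" if "x \<in> F" "y \<in> ball x h" for x y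
  proof -
    have "norm x = 1" "norm (x - y) < h" using that F by (auto simp: dist_norm)
    then show ?thesis using norm_triangle_ineq2[of x y] norm_triangle_ineq2[of y x]
      by (simp add: norm_minus_commute)
  qed
  have fin: "emeasure lborel (ball c r :: 'a set) \<noteq> \<infinity>" for c r
    by (metis emeasure_lborel_ball_finite infinity_ennreal_def less_irrefl)
  have "real (card F) * (\<omega> * h ^ ?n) + \<omega> * (1 - h) ^ ?n =
      (\<Sum>x\<in>F. measure lborel (ball x h)) + measure lborel (ball (0::'a) (1 - h))"
    using h by (simp add: content_ball \<omega>_def)
  also have "(\<Sum>x\<in>F. measure lborel (ball x h)) = measure lborel (\<Union>x\<in>F. ball x h)"
    using F fin disj by (intro measure_finite_Union[symmetric]) auto
  also have "measure lborel (\<Union>x\<in>F. ball x h) + measure lborel (ball (0::'a) (1 - h)) =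
      measure lborel ((\<Union>x\<in>F. ball x h) \<union> ball 0 (1 - h))"
  proof (rule measure_Union[symmetric])
    have "emeasure lborel (\<Union>x\<in>F. ball x h) \<le> (\<Sum>x\<in>F. emeasure lborel (ball x h))"
      using F by (intro emeasure_subadditive_finite) auto
    also have "\<dots> < \<infinity>" using F fin by (simp add: ennreal_sum_less_top less_top)
    finally show "emeasure lborel (\<Union>x\<in>F. ball x h) \<noteq> \<infinity>" by simp
    show "(\<Union>x\<in>F. ball x h) \<inter> ball 0 (1 - h) = {}" using norm by fastforce
  qed (use F fin in \<open>auto intro!: sets.finite_UN\<close>)
  also have "\<dots> \<le> measure lborel (ball (0::'a) (1 + h))"
  proof (rule measure_mono_fmeasurable)
    show "(\<Union>x\<in>F. ball x h) \<union> ball 0 (1 - h) \<subseteq> ball (0::'a) (1 + h)"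
      using norm h by (intro Un_least UN_least) (auto simp del: mem_ball simp: mem_ball_0)
    show "(\<Union>x\<in>F. ball x h) \<union> ball 0 (1 - h) \<in> sets lborel"
      by (simp add: open_UN borel_open open_Un)
    show "ball (0::'a) (1 + h) \<in> fmeasurable lborel"
      using fin by (intro fmeasurableI) (auto simp: less_top)
  qed
  also have "\<dots> = \<omega> * (1 + h) ^ ?n" using h by (simp add: content_ball \<omega>_def)
  finally have "\<omega> * (real (card F) * h ^ ?n) \<le> \<omega> * ((1 + h) ^ ?n - (1 - h) ^ ?n)"
    by (simp add: algebra_simps)
  then have "real (card F) * h ^ ?n \<le> (1 + h) ^ ?n - (1 - h) ^ ?n" using \<omega> by simp
  also have "\<dots> \<le> 2 * h * (real ?n * 2 ^ (?n - 1))" using h by (intro power_diff_le_linear) auto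
  finally have "\<delta> * (real (card F) * \<delta> ^ (?n - 1)) \<le> \<delta> * (real ?n * (2 ^ (?n - 1) * 2 ^ ?n))"
    by (simp add: h_def power_divide power_eq_if[of \<delta> ?n] field_simps)
  then have "real (card F) * \<delta> ^ (?n - 1) \<le> real ?n * (2 ^ (?n - 1) * 2 ^ ?n)"
    using \<delta> by simp
  also have "\<dots> \<le> real ?n * (2 ^ ?n * 2 ^ ?n)"
    by (intro mult_left_mono mult_right_mono power_increasing) auto
  also have "\<dots> = real ?n * 4 ^ ?n" by (simp flip: power_mult_distrib)
  finally show ?thesis .
qed

text \<open>
  A separated set of maximal cardinality is a net.
\<close>

lemma sphere_finite_net:
  fixes \<delta> :: real
  assumes \<delta>: "0 < \<delta>" "\<delta> \<le> 1"
  shows "\<exists>F. finite F \<and> sphere (0::'a::euclidean_space) 1 \<subseteq> (\<Union>x\<in>F. ball x \<delta>) \<and>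
    real (card F) * \<delta> ^ (DIM('a) - 1) \<le> real DIM('a) * 4 ^ DIM('a)"
proof -
  let ?C = "real DIM('a) * 4 ^ DIM('a)"
  define Q where "Q F \<longleftrightarrow> finite F \<and> F \<subseteq> sphere (0::'a) 1 \<and> pairwise (\<lambda>x y. \<delta> \<le> dist x y) F" for F
  have bound: "real (card F) * \<delta> ^ (DIM('a) - 1) \<le> ?C" if "Q F" for F
    using that card_separated_sphere_le[of F \<delta>] \<delta> by (auto simp: Q_def)
  have "\<forall>F. Q F \<longrightarrow> card F < Suc (nat \<lceil>?C / \<delta> ^ (DIM('a) - 1)\<rceil>)"
  proof (intro allI impI)
    fix F assume "Q F"
    then have "real (card F) \<le> ?C / \<delta> ^ (DIM('a) - 1)"
      using bound[of F] \<delta> by (simp add: field_simps)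
    also have "\<dots> \<le> real (nat \<lceil>?C / \<delta> ^ (DIM('a) - 1)\<rceil>)" by (rule real_nat_ceiling_ge)
    finally show "card F < Suc (nat \<lceil>?C / \<delta> ^ (DIM('a) - 1)\<rceil>)" by simp
  qed
  moreover have "Q {}" by (simp add: Q_def)
  ultimately obtain F where F: "Q F" "\<And>G. Q G \<Longrightarrow> card G \<le> card F"
    using Lattices_Big.ex_has_greatest_nat[of Q "{}" card] by metis
  have "sphere 0 1 \<subseteq> (\<Union>x\<in>F. ball x \<delta>)"
  proof (rule ccontr)
    assume "\<not> ?thesis"
    then obtain y where y: "y \<in> sphere 0 1" "\<And>x. x \<in> F \<Longrightarrow> \<delta> \<le> dist x y"
      by (force simp: not_less)
    then have "Q (insert y F)" using F(1) by (auto simp: Q_def pairwise_insert dist_commute)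
    moreover have "y \<notin> F" using y(2)[of y] \<delta> by auto
    ultimately show False using F(2)[of "insert y F"] F(1) by (auto simp: Q_def)
  qed
  moreover have "finite F" using F(1) by (simp add: Q_def)
  ultimately show ?thesis using bound[OF F(1)] by (intro exI[of _ F]) simp
qed

lemma hausdorff_outer_measure_sphere_finite:
  "hausdorff_outer_measure (DIM('a) - 1) (sphere (0::'a::euclidean_space) 1) < top"
proof -
  let ?d = "DIM('a) - 1" and ?S = "sphere (0::'a) 1"
  define C where "C = 2 ^ ?d * (real DIM('a) * 4 ^ DIM('a))"
  have "hausdorff_outer_measure ?d ?S \<le> ennreal C"
    unfolding hausdorff_outer_measure_def
  proof (rule SUP_least)
    fix \<epsilon> :: real assume "\<epsilon> \<in> {0<..}"
    define \<delta> where "\<delta> = min 1 (\<epsilon> / 2)"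
    have \<delta>: "0 < \<delta>" "\<delta> \<le> 1" "2 * \<delta> \<le> \<epsilon>" using \<open>\<epsilon> \<in> {0<..}\<close> by (auto simp: \<delta>_def)
    obtain F where F: "finite F" "?S \<subseteq> (\<Union>x\<in>F. ball x \<delta>)"
        "real (card F) * \<delta> ^ ?d \<le> real DIM('a) * 4 ^ DIM('a)"
      using sphere_finite_net[OF \<delta>(1,2), where 'a = 'a] by blast
    have "hausdorff_premeasure ?d \<epsilon> ?S \<le> ennreal (real (card F) * (2 * \<delta>) ^ ?d)"
      using F \<delta> by (intro hausdorff_premeasure_le_finite_sum[where V="\<lambda>x. ball x \<delta>"]) auto
    also have "real (card F) * (2 * \<delta>) ^ ?d = 2 ^ ?d * (real (card F) * \<delta> ^ ?d)"
      by (simp add: power_mult_distrib)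
    also have "ennreal \<dots> \<le> ennreal C"
      unfolding C_def using F by (intro ennreal_leI mult_left_mono) auto
    finally show "hausdorff_premeasure ?d \<epsilon> ?S \<le> ennreal C" .
  qed
  then show ?thesis by (simp add: le_less_trans)
qed

text \<open>
  The cone over a set of diameter at most \<open>\<eta>\<close> stays within distance \<open>\<eta>\<close> of a single radius, which is
  covered by about \<open>1 / \<eta>\<close> balls of radius \<open>2 * \<eta>\<close>. Its volume is therefore of order \<open>\<eta> ^ (n - 1)\<close>,
  the power of the diameter that enters the Hausdorff measure of the sphere.
\<close>

lemma cone_tube_bound:
  fixes U :: "'a::euclidean_space set"
  assumes U: "U \<subseteq> sphere 0 1" and \<eta>: "0 < \<eta>" "\<eta> \<le> 1"
    and diam: "\<And>x y. x \<in> U \<Longrightarrow> y \<in> U \<Longrightarrow> dist x y \<le> \<eta>"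
  shows "\<exists>V\<in>sets borel. (\<forall>x\<in>U. \<forall>r\<in>{0..1}. r *\<^sub>R x \<in> V) \<and>
    emeasure lborel V \<le> ennreal (3 * 2 ^ DIM('a) * unit_ball_vol (DIM('a)) * \<eta> ^ (DIM('a) - 1))"
proof (cases "U = {}")
  case True
  then show ?thesis by (auto intro!: bexI[of _ "{}"])
next
  case False
  then obtain a where a: "a \<in> U" by blast
  let ?n = "DIM('a)"
  define m where "m = nat \<lfloor>1 / \<eta>\<rfloor>"
  have "real m \<le> 1 / \<eta>" unfolding m_def using \<eta> by simp
  then have m: "real (m + 1) * \<eta> \<le> 3" using \<eta> by (simp add: field_simps)
  define V where "V = (\<Union>j\<le>m. cball ((real j * \<eta>) *\<^sub>R a) (2 * \<eta>))"
  have "r *\<^sub>R x \<in> V" if x: "x \<in> U" and r: "r \<in> {0..1}" for x r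
  proof -
    define j where "j = nat \<lfloor>r / \<eta>\<rfloor>"
    have "0 \<le> r / \<eta>" using r \<eta> by simp
    then have j: "real j \<le> r / \<eta>" "r / \<eta> < real j + 1" unfolding j_def by linarith+
    have "j \<le> m" unfolding j_def m_def using r \<eta> by (intro nat_mono floor_mono divide_right_mono) auto
    have "\<bar>r - real j * \<eta>\<bar> \<le> \<eta>" using j \<eta> by (simp add: field_simps)
    moreover have "norm (x - a) \<le> \<eta>" using diam[OF x a] by (simp add: dist_norm)
    moreover have "norm a = 1" using a U by auto
    moreover have "r *\<^sub>R x - (real j * \<eta>) *\<^sub>R a = r *\<^sub>R (x - a) + (r - real j * \<eta>) *\<^sub>R a"
      by (simp add: algebra_simps)
    ultimately have "norm (r *\<^sub>R x - (real j * \<eta>) *\<^sub>R a) \<le> 1 * \<eta> + \<eta> * 1"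
      using r by (metis (no_types, lifting) norm_triangle_le add_mono atLeastAtMost_iff
          norm_scaleR mult_mono abs_of_nonneg norm_ge_zero zero_le_one mult_1_right)
    then have "r *\<^sub>R x \<in> cball ((real j * \<eta>) *\<^sub>R a) (2 * \<eta>)"
      by (simp add: dist_norm norm_minus_commute)
    then show ?thesis using \<open>j \<le> m\<close> by (auto simp: V_def)
  qed
  moreover have "emeasure lborel V \<le> ennreal (3 * 2 ^ ?n * unit_ball_vol ?n * \<eta> ^ (?n - 1))"
  proof -
    have "emeasure lborel V \<le> (\<Sum>j\<le>m. emeasure lborel (cball ((real j * \<eta>) *\<^sub>R a) (2 * \<eta>)))"
      unfolding V_def by (intro emeasure_subadditive_finite) auto
    also have "\<dots> = ennreal (real (m + 1) * (unit_ball_vol ?n * (2 * \<eta>) ^ ?n))"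
      using \<eta> by (simp add: emeasure_cball ennreal_mult ennreal_of_nat_eq_real_of_nat add.commute
          del: of_nat_Suc of_nat_add)
    also have "real (m + 1) * (unit_ball_vol ?n * (2 * \<eta>) ^ ?n) =
        (real (m + 1) * \<eta>) * (2 ^ ?n * unit_ball_vol ?n * \<eta> ^ (?n - 1))"
      by (simp add: power_mult_distrib power_eq_if[of \<eta> ?n])
    also have "ennreal \<dots> \<le> ennreal (3 * (2 ^ ?n * unit_ball_vol ?n * \<eta> ^ (?n - 1)))"
      using m \<eta> by (intro ennreal_leI mult_right_mono) auto
    finally show ?thesis by (simp only: mult.assoc)
  qed
  moreover have "V \<in> sets borel" unfolding V_def by auto
  ultimately show ?thesis by blast
qed

text \<open>
  The cones over the sets of a cover of the sphere cover the unit ball.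
\<close>

lemma unit_ball_vol_le_diameter_sum:
  fixes U :: "nat \<Rightarrow> 'a::euclidean_space set"
  assumes U: "fine_cover (1/2) (sphere 0 1) U"
  shows "ennreal (unit_ball_vol (DIM('a)))
    \<le> ennreal (3 * 2 ^ DIM('a) * unit_ball_vol (DIM('a))) * diameter_sum (DIM('a) - 1) U"
proof -
  let ?n = "DIM('a)" and ?S = "sphere (0::'a) 1"
  define K where "K = 3 * 2 ^ ?n * unit_ball_vol (real ?n)"
  have K: "0 < K" by (simp add: K_def)
  show ?thesis unfolding K_def[symmetric]
  proof (rule ennreal_le_epsilon)
    fix e :: real assume e: "0 < e"
    have "\<exists>V\<in>sets borel. (\<forall>x\<in>U i \<inter> ?S. \<forall>r\<in>{0..1}. r *\<^sub>R x \<in> V) \<and>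
        emeasure lborel V \<le> ennreal K * diameter_power (?n - 1) (U i) + ennreal (e * (1/2) ^ Suc i)" for i
    proof (cases "U i = {}")
      case True
      then show ?thesis by (intro bexI[of _ "{}"]) auto
    next
      case False
      let ?D = "diameter (U i)"
      have D: "bounded (U i)" "0 \<le> ?D" "?D \<le> 1/2" using U by (auto simp: fine_cover_def diameter_ge_0)
      \<comment> \<open>The diameter may be 0, whereas tubes need a positive width. So a width slightly above
        the diameter is used, at the price of an error that sums up to \<open>e\<close>.\<close>
      have "((\<lambda>x. K * x ^ (?n - 1)) \<longlongrightarrow> K * ?D ^ (?n - 1)) (at_right ?D)" by (intro tendsto_intros)
      then have "\<forall>\<^sub>F x in at_right ?D. K * x ^ (?n - 1) < K * ?D ^ (?n - 1) + e * (1/2) ^ Suc i"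
        using e by (intro order_tendstoD) auto
      moreover have "\<forall>\<^sub>F x in at_right ?D. x < 1"
        using D by (intro order_tendstoD[OF tendsto_ident_at]) auto
      moreover have "\<forall>\<^sub>F x in at_right ?D. ?D < x" by (simp add: eventually_at_right_less)
      ultimately have "\<forall>\<^sub>F x in at_right ?D. K * x ^ (?n - 1) < K * ?D ^ (?n - 1) + e * (1/2) ^ Suc i \<and> x < 1 \<and> ?D < x"
        by eventually_elim auto
      then obtain \<eta> where \<eta>: "K * \<eta> ^ (?n - 1) < K * ?D ^ (?n - 1) + e * (1/2) ^ Suc i" "\<eta> < 1" "?D < \<eta>"
        using eventually_happens'[OF trivial_limit_at_right_real] by blast
      have "dist x y \<le> \<eta>" if "x \<in> U i \<inter> ?S" "y \<in> U i \<inter> ?S" for x y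
        using diameter_bounded_bound[OF D(1), of x y] that \<eta> by auto
      then obtain V where V: "V \<in> sets borel" "\<And>x r. x \<in> U i \<inter> ?S \<Longrightarrow> r \<in> {0..1} \<Longrightarrow> r *\<^sub>R x \<in> V"
          "emeasure lborel V \<le> ennreal (K * \<eta> ^ (?n - 1))"
        using cone_tube_bound[of "U i \<inter> ?S" \<eta>] \<eta> D by (auto simp: K_def)
      note V(3)
      also have "ennreal (K * \<eta> ^ (?n - 1)) \<le> ennreal (K * ?D ^ (?n - 1) + e * (1/2) ^ Suc i)"
        using \<eta> by (intro ennreal_leI) auto
      also have "\<dots> = ennreal K * diameter_power (?n - 1) (U i) + ennreal (e * (1/2) ^ Suc i)"
        using e K D False by (simp add: diameter_power_def ennreal_plus ennreal_mult)
      finally show ?thesis using V(1,2) by blast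
    qed
    then obtain V where V: "\<And>i. V i \<in> sets borel"
        "\<And>i x r. x \<in> U i \<inter> ?S \<Longrightarrow> r \<in> {0..1} \<Longrightarrow> r *\<^sub>R x \<in> V i"
        "\<And>i. emeasure lborel (V i) \<le> ennreal K * diameter_power (?n - 1) (U i) + ennreal (e * (1/2) ^ Suc i)"
      by metis
    have "ball 0 1 \<subseteq> (\<Union>i. V i)"
    proof
      fix x :: 'a assume x: "x \<in> ball 0 1"
      obtain y where y: "y \<in> ?S" "x = norm x *\<^sub>R y"
      proof (cases "x = 0")
        case True
        obtain b :: 'a where "b \<in> Basis" using nonempty_Basis by blast
        then show ?thesis using that[of b] True by auto
      next
        case False
        then show ?thesis using that[of "x /\<^sub>R norm x"] by auto
      qed
      obtain i where "y \<in> U i" using y U by (auto simp: fine_cover_def)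
      then have "norm x *\<^sub>R y \<in> V i" using V(2)[of y i "norm x"] y(1) x by auto
      then show "x \<in> (\<Union>i. V i)" using y(2) by auto
    qed
    then have "emeasure lborel (ball (0::'a) 1) \<le> emeasure lborel (\<Union>i. V i)"
      using V(1) by (intro emeasure_mono) auto
    also have "\<dots> \<le> (\<Sum>i. emeasure lborel (V i))"
      using V(1) by (intro emeasure_subadditive_countably) auto
    also have "\<dots> \<le> (\<Sum>i. ennreal K * diameter_power (?n - 1) (U i) + ennreal (e * (1/2) ^ Suc i))"
      by (intro suminf_le V summableI)
    also have "\<dots> = ennreal K * diameter_sum (?n - 1) U + (\<Sum>i. ennreal e * ennreal ((1/2) ^ Suc i))"
      using e by (subst suminf_add[symmetric])
        (auto simp: diameter_sum_def ennreal_mult[symmetric] simp del: ennreal_suminf_cmult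
          simp flip: ennreal_suminf_cmult[of "ennreal K"])
    also have "(\<Sum>i. ennreal e * ennreal ((1/2) ^ Suc i)) = ennreal e"
      unfolding ennreal_suminf_cmult
      by (subst suminf_ennreal_eq[OF zero_le_power power_half_series]) auto
    finally show "ennreal (unit_ball_vol (real ?n)) \<le> ennreal K * diameter_sum (?n - 1) U + ennreal e"
      by (simp add: emeasure_ball)
  qed
qed

lemma hausdorff_outer_measure_sphere_pos:
  "0 < hausdorff_outer_measure (DIM('a) - 1) (sphere (0::'a::euclidean_space) 1)"
proof (rule ccontr)
  let ?n = "DIM('a)" and ?S = "sphere (0::'a) 1"
  define K where "K = 3 * (2::real) ^ ?n"
  have K: "0 < K" by (simp add: K_def)
  assume "\<not> ?thesis"
  then have "hausdorff_premeasure (?n - 1) (1/2) ?S \<le> 0"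
    using hausdorff_premeasure_le_outer[of "1/2" "?n - 1" ?S] by simp
  also have "0 < ennreal (1 / K)" using K by simp
  finally obtain U where U: "fine_cover (1/2) ?S U" "diameter_sum (?n - 1) U < ennreal (1 / K)"
    using hausdorff_premeasure_less_iff by blast
  have "ennreal (K * unit_ball_vol (real ?n)) * diameter_sum (?n - 1) U
      < ennreal (K * unit_ball_vol (real ?n)) * ennreal (1 / K)"
    using U(2) K by (intro ennreal_mult_strict_left_mono) auto
  also have "\<dots> = ennreal (unit_ball_vol (real ?n))"
    using K by (simp flip: ennreal_mult')
  also have "\<dots> \<le> ennreal (K * unit_ball_vol (real ?n)) * diameter_sum (?n - 1) U"
    unfolding K_def by (rule unit_ball_vol_le_diameter_sum[OF U(1)])
  finally show False by simp
qed

section \<open>Rotation-invariant measures on the sphere and their moments\<close>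

text \<open>
  The reflection in the hyperplane orthogonal to \<open>u - v\<close>.
\<close>

lemma exists_orthogonal_transformation_mapping:
  fixes u v :: "'a::real_inner"
  assumes "norm u = norm v"
  shows "\<exists>T. orthogonal_transformation T \<and> T u = v"
proof (cases "u = v")
  case True
  then show ?thesis using orthogonal_transformation_id by blast
next
  case False
  define w where "w = u - v"
  define c where "c x = 2 * (x \<bullet> w) / (w \<bullet> w)" for x
  define T where "T x = x - c x *\<^sub>R w" for x
  have w: "w \<bullet> w \<noteq> 0" using False by (simp add: w_def)
  have uv: "u \<bullet> u = v \<bullet> v" using assms by (simp add: norm_eq)
  have "linear T"
    unfolding T_def c_def by (rule linearI) (simp_all add: inner_add_left algebra_simps add_divide_distrib)
  moreover have "T x \<bullet> T y = x \<bullet> y" for x y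
  proof -
    have "T x \<bullet> T y = x \<bullet> y - c y * (x \<bullet> w) - c x * (y \<bullet> w) + c x * c y * (w \<bullet> w)"
      by (simp add: T_def inner_diff_left inner_diff_right inner_commute[of w y] algebra_simps)
    moreover have "c x * c y * (w \<bullet> w) = c y * (2 * (x \<bullet> w))" using w by (simp add: c_def)
    moreover have "c x * (y \<bullet> w) = c y * (x \<bullet> w)" by (simp add: c_def)
    ultimately show ?thesis by simp
  qed
  moreover have "T u = v"
  proof -
    have "2 * (u \<bullet> w) = w \<bullet> w"
      using uv by (simp add: w_def inner_diff_left inner_diff_right inner_commute[of v u])
    then have "c u = 1" using w by (simp add: c_def)
    then show ?thesis by (simp add: T_def w_def)
  qed
  ultimately show ?thesis unfolding orthogonal_transformation_def by blast
qed

text \<open>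
  The sphere carries the measure, but the measure lives on the Borel sets of the whole space; this
  keeps polynomials and half-spaces available as functions and sets on the full space.
\<close>

locale rotation_invariant_sphere_measure = prob_space P for P :: "'a::euclidean_space measure" +
  assumes sets_eq_borel [simp, measurable_cong]: "sets P = sets borel"
    and AE_sphere: "AE x in P. x \<in> sphere 0 1"
    and distr_orthogonal: "orthogonal_transformation T \<Longrightarrow> distr P borel T = P"

lemma hausdorff_outer_measure_orthogonal_vimage:
  fixes T :: "'a::euclidean_space \<Rightarrow> 'a"
  assumes T: "orthogonal_transformation T"
  shows "hausdorff_outer_measure d (T -` A) = hausdorff_outer_measure d A"
proof (rule antisym)
  have iso: "dist (f x) (f y) = dist x y" if "orthogonal_transformation f" for f :: "'a \<Rightarrow> 'a" and x y
    using that by (metis dist_norm linear_diff orthogonal_transformation_linear orthogonal_transformation_norm)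
  have bij: "bij T" using T by (rule orthogonal_transformation_bij)
  have "hausdorff_outer_measure d (inv T ` A) \<le> hausdorff_outer_measure d A"
    by (intro hausdorff_outer_measure_isometry_le iso orthogonal_transformation_inv T)
  then show "hausdorff_outer_measure d (T -` A) \<le> hausdorff_outer_measure d A"
    by (simp add: bij_vimage_eq_inv_image[OF bij])
  have "hausdorff_outer_measure d (T ` (T -` A)) \<le> hausdorff_outer_measure d (T -` A)"
    by (intro hausdorff_outer_measure_isometry_le iso T)
  then show "hausdorff_outer_measure d A \<le> hausdorff_outer_measure d (T -` A)"
    using bij by (simp add: bij_is_surj)
qed

lemma borel_measurable_orthogonal_transformation:
  fixes T :: "'a::euclidean_space \<Rightarrow> 'a"
  assumes "orthogonal_transformation T"
  shows "T \<in> borel_measurable borel"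
  by (intro borel_measurable_continuous_onI linear_continuous_on linear_conv_bounded_linear[THEN iffD1]
      orthogonal_transformation_linear assms)

text \<open>
  Because the sphere has positive and finite measure, the normalization is genuine; invariance is
  inherited from the isometry invariance of the Hausdorff outer measure.
\<close>

theorem sphere_prob_rotation_invariant:
  "rotation_invariant_sphere_measure (sphere_prob :: 'a::euclidean_space measure)"
proof -
  let ?H = "hausdorff_measure (DIM('a) - 1) :: 'a measure" and ?S = "sphere (0::'a) 1"
  have S: "?S \<in> sets borel" by simp
  have H: "emeasure ?H ?S \<noteq> 0" "emeasure ?H ?S \<noteq> \<infinity>"
    using hausdorff_outer_measure_sphere_pos[where 'a='a] hausdorff_outer_measure_sphere_finite[where 'a='a]
    by (auto simp: emeasure_hausdorff_measure)
  have sets: "sets (sphere_prob :: 'a measure) = sets borel" by (simp add: sphere_prob_def)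
  interpret prob_space "sphere_prob :: 'a measure"
    unfolding sphere_prob_def by (rule prob_space_uniform_measure[OF H])
  show ?thesis
  proof
    show "sets (sphere_prob :: 'a measure) = sets borel" by (rule sets)
    show "AE x in sphere_prob. x \<in> ?S"
      unfolding sphere_prob_def by (rule AE_uniform_measureI) simp_all
    show "distr sphere_prob borel T = sphere_prob" if T: "orthogonal_transformation T" for T :: "'a \<Rightarrow> 'a"
    proof (rule measure_eqI)
      have meas: "T \<in> measurable sphere_prob borel"
        using borel_measurable_orthogonal_transformation[OF T] by (simp cong: measurable_cong_sets add: sets)
      show "sets (distr sphere_prob borel T) = sets (sphere_prob :: 'a measure)" by (simp add: sets)
      fix A assume "A \<in> sets (distr sphere_prob borel T)"
      then have A: "A \<in> sets borel" by simp
      have TA: "T -` A \<in> sets borel"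
        using measurable_sets[OF borel_measurable_orthogonal_transformation[OF T] A] by simp
      have "?S \<inter> T -` A = T -` (?S \<inter> A)"
        using orthogonal_transformation_norm[OF T] by auto
      moreover have "?S \<inter> A \<in> sets borel" "?S \<inter> T -` A \<in> sets borel" using A TA S by auto
      ultimately have "emeasure ?H (?S \<inter> T -` A) = emeasure ?H (?S \<inter> A)"
        by (simp add: emeasure_hausdorff_measure hausdorff_outer_measure_orthogonal_vimage[OF T] del: vimage_Int)
      then show "emeasure (distr sphere_prob borel T) A = emeasure sphere_prob A"
        unfolding emeasure_distr[OF meas A] using A TA sets_eq_imp_space_eq[OF sets]
        by (simp add: sphere_prob_def)
    qed
  qed
qed

context rotation_invariant_sphere_measure
begin

lemma integrable_continuous:
  fixes f :: "'a \<Rightarrow> 'b::{banach, second_countable_topology}"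
  assumes "continuous_on UNIV f"
  shows "integrable P f"
proof -
  have "compact (f ` sphere 0 1)"
    using assms continuous_on_subset by (intro compact_continuous_image) auto
  then obtain B where B: "\<And>x. x \<in> sphere 0 1 \<Longrightarrow> norm (f x) \<le> B"
    using compact_imp_bounded bounded_iff by (metis image_eqI)
  show ?thesis
  proof (rule integrable_const_bound[of _ B])
    show "AE x in P. norm (f x) \<le> B" using AE_sphere by eventually_elim (rule B)
    show "f \<in> borel_measurable P"
      using borel_measurable_continuous_onI[OF assms] by (simp cong: measurable_cong_sets)
  qed
qed

lemma integral_orthogonal_transformation:
  fixes f :: "'a \<Rightarrow> 'b::{banach, second_countable_topology}"
  assumes T: "orthogonal_transformation T" and f: "f \<in> borel_measurable borel"
  shows "(\<integral>x. f (T x) \<partial>P) = (\<integral>x. f x \<partial>P)"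
proof -
  have "T \<in> measurable P borel"
    using borel_measurable_orthogonal_transformation[OF T] by (simp cong: measurable_cong_sets)
  then have "(\<integral>x. f (T x) \<partial>P) = (\<integral>x. f x \<partial>distr P borel T)" using f by (simp add: integral_distr)
  then show ?thesis by (simp only: distr_orthogonal[OF T])
qed

text \<open>
  Every unit vector in place of the chosen basis vector gives the same value, by invariance
  (\<open>integral_inner_power\<close>).
\<close>

definition moment :: "nat \<Rightarrow> real" where
  "moment m = (\<integral>x. (x \<bullet> (SOME e. e \<in> Basis)) ^ m \<partial>P)"

lemma integral_inner_power: "(\<integral>x. (x \<bullet> v) ^ m \<partial>P) = moment m * norm v ^ m"
proof (cases "v = 0")
  case True
  then show ?thesis by (cases m) (auto simp: moment_def)
next
  case False
  define e :: 'a where "e = (SOME e. e \<in> Basis)"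
  have "e \<in> Basis" unfolding e_def by (rule someI_ex) (use nonempty_Basis in blast)
  then obtain T where T: "orthogonal_transformation T" "T e = v /\<^sub>R norm v"
    using exists_orthogonal_transformation_mapping[of e "v /\<^sub>R norm v"] False by auto
  have "moment m = (\<integral>x. (T x \<bullet> T e) ^ m \<partial>P)"
    using T(1) by (simp add: moment_def e_def[symmetric] orthogonal_transformation_def)
  also have "\<dots> = (\<integral>x. (x \<bullet> T e) ^ m \<partial>P)"
    by (intro integral_orthogonal_transformation[OF T(1), of "\<lambda>x. (x \<bullet> T e) ^ m"]
        borel_measurable_continuous_onI continuous_intros)
  also have "\<dots> = (\<integral>x. (inverse (norm v)) ^ m * (x \<bullet> v) ^ m \<partial>P)"
    by (simp add: T(2) power_mult_distrib)
  also have "\<dots> = (inverse (norm v)) ^ m * (\<integral>x. (x \<bullet> v) ^ m \<partial>P)" by simp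
  finally show ?thesis using False by (simp add: field_simps)
qed

lemma integral_inner_even_power: "(\<integral>x. (x \<bullet> v) ^ (2 * M) \<partial>P) = moment (2 * M) * (v \<bullet> v) ^ M"
  unfolding integral_inner_power by (simp add: power_mult power2_norm_eq_inner)

lemma integral_odd_eq_0:
  fixes f :: "'a \<Rightarrow> 'b::{banach, second_countable_topology}"
  assumes "f \<in> borel_measurable borel" "\<And>x. f (- x) = - f x"
  shows "(\<integral>x. f x \<partial>P) = 0"
proof -
  have "(\<integral>x. f (- x) \<partial>P) = (\<integral>x. f x \<partial>P)"
    by (rule integral_orthogonal_transformation[of uminus, OF _ assms(1)])
      (simp add: orthogonal_transformation_neg[of "\<lambda>x. x", simplified])
  then have "- (\<integral>x. f x \<partial>P) = (\<integral>x. f x \<partial>P)" by (simp add: assms(2))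
  then have "2 *\<^sub>R (\<integral>x. f x \<partial>P) = 0" by (simp add: scaleR_2 add_eq_0_iff)
  then show ?thesis by simp
qed

lemma moment_0: "moment 0 = 1"
  by (simp add: moment_def prob_space)

text \<open>
  The integral is a polynomial in \<open>z\<close>, with mixed moments as its coefficients; comparing it with an
  explicit polynomial determines these moments.
\<close>

lemma integral_inner_power_expand:
  fixes f g :: "'a \<Rightarrow> 'b::{real_normed_field, banach, second_countable_topology}"
  assumes "continuous_on UNIV f" "continuous_on UNIV g"
  shows "(\<integral>x. (z * g x + f x) ^ m \<partial>P) =
    poly (\<Sum>j\<le>m. monom (of_nat (m choose j) * (\<integral>x. f x ^ (m - j) * g x ^ j \<partial>P)) j) z"
proof -
  have int: "integrable P (\<lambda>x. f x ^ (m - j) * g x ^ j)" for j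
    using assms by (intro integrable_continuous continuous_intros)
  have "(\<integral>x. (z * g x + f x) ^ m \<partial>P) =
      (\<integral>x. (\<Sum>j\<le>m. (of_nat (m choose j) * z ^ j) * (f x ^ (m - j) * g x ^ j)) \<partial>P)"
    by (simp add: binomial_ring power_mult_distrib mult_ac)
  also have "\<dots> = (\<Sum>j\<le>m. (of_nat (m choose j) * z ^ j) * (\<integral>x. f x ^ (m - j) * g x ^ j \<partial>P))"
    using int by simp
  finally show ?thesis by (simp add: poly_sum poly_monom mult_ac)
qed

lemma coeff_sum_monom: "coeff (\<Sum>j\<le>m. monom (c j) j) k = (if k \<le> m then c k else 0)"
  by (simp add: coeff_sum)

lemma coeff_2_one_plus_square_power: "coeff ([:1, 0, 1:] ^ M) 2 = (of_nat M :: real)"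
proof (induction M)
  case (Suc M)
  have "coeff ([:1, 0, 1:] ^ M) 0 = (1::real)" by (induction M) (simp_all add: coeff_mult)
  then show ?case using Suc by (simp add: coeff_pCons numeral_2_eq_2)
qed simp

text \<open>
  For distinct basis vectors \<open>u\<close> and \<open>e\<close>, the coefficient of \<open>t\<^sup>2\<close> in the moment of \<open>u + t e\<close>
  expresses the mixed moment \<open>\<integral> (x \<bullet> u) ^ (2 * M) * (x \<bullet> e)\<^sup>2\<close> by the moment of order \<open>2 * M + 2\<close>.
  Summing over all basis vectors \<open>e\<close> and using \<open>|x| = 1\<close> recovers the moment of order \<open>2 * M\<close>.
\<close>

lemma moment_recurrence:
  "moment (2 * Suc M) * real (2 * M + DIM('a)) = real (2 * M + 1) * moment (2 * M)"
proof -
  obtain u :: 'a where u: "u \<in> Basis" using nonempty_Basis by blast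
  have mixed: "(\<integral>x. (x \<bullet> u) ^ (2 * M) * (x \<bullet> e)\<^sup>2 \<partial>P) * real (2 * M + 1) = moment (2 * Suc M)"
    if e: "e \<in> Basis" "e \<noteq> u" for e
  proof -
    let ?p = "\<Sum>j\<le>2 * Suc M. monom (of_nat ((2 * Suc M) choose j) *
        (\<integral>x. (x \<bullet> u) ^ (2 * Suc M - j) * (x \<bullet> e) ^ j \<partial>P)) j"
    have "poly ?p t = poly (smult (moment (2 * Suc M)) ([:1, 0, 1:] ^ Suc M)) t" for t
    proof -
      have "poly ?p t = (\<integral>x. (t * (x \<bullet> e) + x \<bullet> u) ^ (2 * Suc M) \<partial>P)"
        by (intro integral_inner_power_expand[symmetric] continuous_intros)
      also have "\<dots> = (\<integral>x. (x \<bullet> (t *\<^sub>R e + u)) ^ (2 * Suc M) \<partial>P)"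
        by (simp add: inner_add_right)
      also have "\<dots> = moment (2 * Suc M) * ((t *\<^sub>R e + u) \<bullet> (t *\<^sub>R e + u)) ^ Suc M"
        by (rule integral_inner_even_power)
      also have "(t *\<^sub>R e + u) \<bullet> (t *\<^sub>R e + u) = 1 + t * t"
        using e u by (simp add: inner_add_left inner_add_right inner_Basis)
      finally show ?thesis by (simp add: algebra_simps)
    qed
    then have "?p = smult (moment (2 * Suc M)) ([:1, 0, 1:] ^ Suc M)"
      unfolding poly_eq_poly_eq_iff[symmetric] by (rule ext)
    then have "coeff ?p 2 = coeff (smult (moment (2 * Suc M)) ([:1, 0, 1:] ^ Suc M)) 2"
      by (rule arg_cong)
    then have "real ((2 * Suc M) choose 2) * (\<integral>x. (x \<bullet> u) ^ (2 * M) * (x \<bullet> e)\<^sup>2 \<partial>P)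
        = moment (2 * Suc M) * real (Suc M)"
      unfolding coeff_sum_monom by (simp add: coeff_2_one_plus_square_power del: power_Suc)
    moreover have "real ((2 * Suc M) choose 2) = real (2 * M + 1) * real (Suc M)"
      by (simp add: choose_two algebra_simps)
    ultimately show ?thesis by (simp add: field_simps del: of_nat_Suc)
  qed
  have "moment (2 * M) = (\<integral>x. (x \<bullet> u) ^ (2 * M) \<partial>P)"
    using u by (simp add: integral_inner_power)
  also have "\<dots> = (\<integral>x. (\<Sum>e\<in>Basis. (x \<bullet> u) ^ (2 * M) * (x \<bullet> e)\<^sup>2) \<partial>P)"
  proof (rule integral_cong_AE)
    show "AE x in P. (x \<bullet> u) ^ (2 * M) = (\<Sum>e\<in>Basis. (x \<bullet> u) ^ (2 * M) * (x \<bullet> e)\<^sup>2)"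
      using AE_sphere
    proof eventually_elim
      case (elim x)
      then have "x \<bullet> x = 1" by (simp add: norm_eq_1)
      then have "(\<Sum>e\<in>Basis. (x \<bullet> e)\<^sup>2) = 1" by (subst (asm) euclidean_inner) (simp add: power2_eq_square)
      then show ?case by (simp flip: sum_distrib_left)
    qed
  qed (use borel_measurable_continuous_onI in \<open>auto simp: measurable_cong_sets[OF sets_eq_borel refl]\<close>)
  also have "\<dots> = (\<Sum>e\<in>Basis. \<integral>x. (x \<bullet> u) ^ (2 * M) * (x \<bullet> e)\<^sup>2 \<partial>P)"
    by (intro Bochner_Integration.integral_sum integrable_continuous continuous_intros)
  also have "\<dots> = (\<integral>x. (x \<bullet> u) ^ (2 * M) * (x \<bullet> u)\<^sup>2 \<partial>P) +
      (\<Sum>e\<in>Basis - {u}. \<integral>x. (x \<bullet> u) ^ (2 * M) * (x \<bullet> e)\<^sup>2 \<partial>P)"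
    using u by (intro sum.remove) auto
  also have "(\<integral>x. (x \<bullet> u) ^ (2 * M) * (x \<bullet> u)\<^sup>2 \<partial>P) = moment (2 * Suc M)"
    using u integral_inner_power[of u "2 * Suc M"] by (simp flip: power_add)
  also have "(\<Sum>e\<in>Basis - {u}. \<integral>x. (x \<bullet> u) ^ (2 * M) * (x \<bullet> e)\<^sup>2 \<partial>P) =
      (\<Sum>e\<in>Basis - {u}. moment (2 * Suc M) / real (2 * M + 1))"
    by (intro sum.cong refl) (subst mixed[symmetric], auto)
  also have "\<dots> = (real DIM('a) - 1) * moment (2 * Suc M) / real (2 * M + 1)"
    using u by (simp add: of_nat_diff Suc_leI)
  finally show ?thesis by (simp add: field_simps)
qed

lemma moment_even_pos: "0 < moment (2 * M)"
proof (induction M)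
  case (Suc M)
  have "0 < real (2 * M + 1) * moment (2 * M)" using Suc by simp
  then have "0 < moment (2 * Suc M) * real (2 * M + DIM('a))" by (simp only: moment_recurrence)
  then show ?case by (simp add: zero_less_mult_iff)
qed (simp add: moment_0)

lemma poly_eqI_of_real:
  fixes p q :: "complex poly"
  assumes "\<And>t::real. poly p (of_real t) = poly q (of_real t)"
  shows "p = q"
proof (rule ccontr)
  assume "p \<noteq> q"
  then have "finite {z. poly (p - q) z = 0}" by (intro poly_roots_finite) simp
  moreover have "range complex_of_real \<subseteq> {z. poly (p - q) z = 0}" using assms by auto
  ultimately have "finite (range complex_of_real)" by (rule rev_finite_subset)
  then show False by (simp add: finite_image_iff inj_of_real infinite_UNIV_char_0)
qed

text \<open>
  Both sides are polynomials in \<open>z\<close> that agree for real \<open>z\<close>, where they express the moment of the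
  real vector \<open>a + z b\<close>.
\<close>

lemma integral_complex_inner_even_power:
  fixes z :: complex
  shows "(\<integral>x. (z * of_real (x \<bullet> b) + of_real (x \<bullet> a)) ^ (2 * M) \<partial>P) =
    of_real (moment (2 * M)) * (of_real (a \<bullet> a) + 2 * z * of_real (a \<bullet> b) + z\<^sup>2 * of_real (b \<bullet> b)) ^ M"
proof -
  let ?p = "\<Sum>j\<le>2 * M. monom (of_nat ((2 * M) choose j) *
      (\<integral>x. complex_of_real (x \<bullet> a) ^ (2 * M - j) * of_real (x \<bullet> b) ^ j \<partial>P)) j"
  let ?q = "smult (of_real (moment (2 * M)))
      ([:of_real (a \<bullet> a), 2 * of_real (a \<bullet> b), of_real (b \<bullet> b):] ^ M) :: complex poly"
  have p: "poly ?p z = (\<integral>x. (z * of_real (x \<bullet> b) + of_real (x \<bullet> a)) ^ (2 * M) \<partial>P)" for z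
    by (intro integral_inner_power_expand[symmetric] continuous_intros)
  have "?p = ?q"
  proof (rule poly_eqI_of_real)
    fix t :: real
    have "poly ?p (of_real t) = (\<integral>x. of_real ((x \<bullet> (t *\<^sub>R b + a)) ^ (2 * M)) \<partial>P)"
      unfolding p by (simp add: inner_add_right)
    also have "\<dots> = of_real (moment (2 * M) * ((t *\<^sub>R b + a) \<bullet> (t *\<^sub>R b + a)) ^ M)"
      by (simp only: integral_complex_of_real integral_inner_even_power)
    also have "(t *\<^sub>R b + a) \<bullet> (t *\<^sub>R b + a) = a \<bullet> a + t * (2 * (a \<bullet> b) + t * (b \<bullet> b))"
      by (simp add: inner_add_left inner_add_right inner_commute algebra_simps)
    finally show "poly ?p (of_real t) = poly ?q (of_real t)" by simp
  qed
  then have "poly ?p z = poly ?q z" by simp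
  then show ?thesis unfolding p by (simp add: algebra_simps power2_eq_square)
qed

end

section \<open>Integrals of zonal powers against a plane harmonic\<close>

text \<open>
  The bilinear product of \<open>x\<close> with the complex vector \<open>e1 + \<i> e2\<close>. For orthonormal \<open>e1\<close>, \<open>e2\<close> this
  vector is isotropic, so the powers of this function are harmonic.
\<close>

definition plane_coord :: "'a::euclidean_space \<Rightarrow> 'a \<Rightarrow> 'a \<Rightarrow> complex" where
  "plane_coord e1 e2 x = Complex (x \<bullet> e1) (x \<bullet> e2)"

lemma continuous_plane_coord [continuous_intros]: "continuous_on S (plane_coord e1 e2)"
  unfolding plane_coord_def complex_eq by (intro continuous_intros)

lemma plane_coord_minus: "plane_coord e1 e2 (- x) = - plane_coord e1 e2 x"
  by (simp add: plane_coord_def complex_eq_iff)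

lemma coeff_one_plus_linear_power:
  fixes c :: "'a::comm_semiring_1"
  shows "coeff ([:1, c:] ^ n) k = of_nat (n choose k) * c ^ k"
proof (cases "k \<le> n")
  case False
  have "degree ([:1, c:] ^ n) \<le> degree [:1, c:] * n" by (rule degree_power_le)
  also have "\<dots> \<le> 1 * n" by (intro mult_right_mono) auto
  finally show ?thesis using False by (simp add: coeff_eq_0 binomial_eq_0)
qed (simp add: coeff_linear_poly_power)

context rotation_invariant_sphere_measure
begin

text \<open>
  Since \<open>e1 + \<i> e2\<close> is isotropic, the quadratic form at \<open>u + t (e1 + \<i> e2)\<close> is only linear in \<open>t\<close>.
  The moment of this vector is thus a multiple of \<open>(1 + 2 t \<zeta>(u)) ^ M\<close>, and the coefficient of
  \<open>t ^ k\<close> is a multiple of \<open>\<zeta>(u) ^ k\<close>.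
\<close>

lemma integral_inner_plane_coord_even:
  assumes u: "norm u = 1" and e: "norm e1 = 1" "norm e2 = 1" "e1 \<bullet> e2 = 0" and k: "k \<le> 2 * M"
  shows "of_nat ((2 * M) choose k) *
      (\<integral>x. of_real (x \<bullet> u) ^ (2 * M - k) * plane_coord e1 e2 x ^ k \<partial>P) =
    of_real (moment (2 * M)) * of_nat (M choose k) * (2 * plane_coord e1 e2 u) ^ k"
proof -
  let ?\<zeta> = "plane_coord e1 e2"
  let ?p = "\<Sum>j\<le>2 * M. monom (of_nat ((2 * M) choose j) *
      (\<integral>x. complex_of_real (x \<bullet> u) ^ (2 * M - j) * ?\<zeta> x ^ j \<partial>P)) j"
  let ?q = "smult (of_real (moment (2 * M))) ([:1, 2 * ?\<zeta> u:] ^ M)"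
  have "?p = ?q"
  proof (rule poly_eqI_of_real)
    fix t :: real
    define a b where "a = u + t *\<^sub>R e1" and "b = t *\<^sub>R e2"
    have "poly ?p (of_real t) = (\<integral>x. (of_real t * ?\<zeta> x + of_real (x \<bullet> u)) ^ (2 * M) \<partial>P)"
      by (intro integral_inner_power_expand[symmetric] continuous_intros)
    also have "\<dots> = (\<integral>x. (\<i> * of_real (x \<bullet> b) + of_real (x \<bullet> a)) ^ (2 * M) \<partial>P)"
    proof -
      have "of_real t * ?\<zeta> x + of_real (x \<bullet> u) = \<i> * of_real (x \<bullet> b) + of_real (x \<bullet> a)" for x
        by (simp add: a_def b_def plane_coord_def complex_eq_iff inner_add_right)
      then show ?thesis by simp
    qed
    also have "\<dots> = of_real (moment (2 * M)) *
        (of_real (a \<bullet> a) + 2 * \<i> * of_real (a \<bullet> b) + \<i>\<^sup>2 * of_real (b \<bullet> b)) ^ M"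
      by (rule integral_complex_inner_even_power)
    also have "of_real (a \<bullet> a) + 2 * \<i> * of_real (a \<bullet> b) + \<i>\<^sup>2 * of_real (b \<bullet> b)
        = 1 + of_real t * (2 * ?\<zeta> u)"
    proof -
      have "u \<bullet> u = 1" "e1 \<bullet> e1 = 1" "e2 \<bullet> e2 = 1" using u e by (simp_all add: norm_eq_1)
      then show ?thesis
        using e by (simp add: a_def b_def plane_coord_def complex_eq_iff inner_add_left inner_add_right
            inner_commute[of e1 u] algebra_simps)
    qed
    finally show "poly ?p (of_real t) = poly ?q (of_real t)" by simp
  qed
  then have "coeff ?p k = coeff ?q k" by (rule arg_cong)
  then show ?thesis using k unfolding coeff_sum_monom by (simp add: coeff_one_plus_linear_power mult_ac)
qed

text \<open>
  The eigenvalue of the zonal kernel \<open>(x \<bullet> u) ^ a\<close> on harmonics of degree \<open>k\<close>.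
\<close>

definition funk_hecke_factor :: "nat \<Rightarrow> nat \<Rightarrow> real" where
  "funk_hecke_factor k a = (if even (a + k)
     then moment (a + k) * real (((a + k) div 2) choose k) * 2 ^ k / real ((a + k) choose k) else 0)"

lemma funk_hecke_monomial:
  assumes u: "norm u = 1" and e: "norm e1 = 1" "norm e2 = 1" "e1 \<bullet> e2 = 0"
  shows "(\<integral>x. of_real (x \<bullet> u) ^ a * plane_coord e1 e2 x ^ k \<partial>P) =
    of_real (funk_hecke_factor k a) * plane_coord e1 e2 u ^ k"
proof (cases "even (a + k)")
  case True
  define M where "M = (a + k) div 2"
  have M: "a + k = 2 * M" using True by (simp add: M_def)
  then have a: "a = 2 * M - k" "k \<le> 2 * M" by auto
  have "(2 * M) choose k \<noteq> 0" using a by (simp add: binomial_eq_0_iff)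
  then show ?thesis
    using integral_inner_plane_coord_even[OF u e a(2), folded a(1)] M
    by (simp add: funk_hecke_factor_def power_mult_distrib field_simps)
next
  case False
  have "(\<integral>x. of_real (x \<bullet> u) ^ a * plane_coord e1 e2 x ^ k \<partial>P) = 0"
  proof (rule integral_odd_eq_0)
    show "(\<lambda>x. of_real (x \<bullet> u) ^ a * plane_coord e1 e2 x ^ k) \<in> borel_measurable borel"
      by (intro borel_measurable_continuous_onI continuous_intros)
    fix x
    show "of_real (- x \<bullet> u) ^ a * plane_coord e1 e2 (- x) ^ k =
        - (of_real (x \<bullet> u) ^ a * plane_coord e1 e2 x ^ k)"
      using False by (cases "even a") (auto simp: plane_coord_minus)
  qed
  then show ?thesis using False by (simp add: funk_hecke_factor_def)
qed

lemma funk_hecke_factor_less: "a < k \<Longrightarrow> funk_hecke_factor k a = 0"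
  by (auto simp: funk_hecke_factor_def binomial_eq_0)

lemma funk_hecke_factor_diag_pos: "0 < funk_hecke_factor k k"
  using moment_even_pos[of k] by (simp add: funk_hecke_factor_def mult_2 flip: mult_2)

text \<open>
  Up to the shift by one caused by differentiation, this is the recurrence for the moments of a
  Legendre polynomial of degree \<open>k - 1\<close> in dimension \<open>n + 2\<close> (\<open>legendre_poly_moment_recurrence\<close>).
\<close>

lemma funk_hecke_factor_recurrence:
  assumes b: "2 \<le> b"
  shows "funk_hecke_factor k b * (real b - real k) * (real b + real k + real DIM('a) - 2) =
    real b * (real b - 1) * funk_hecke_factor k (b - 2)"
proof (cases "even (b + k)")
  case False
  then show ?thesis using b by (simp add: funk_hecke_factor_def)
next
  case True
  define N where "N = (b + k) div 2 - 1"
  have N: "b + k = 2 * Suc N" using b True by (simp add: N_def)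
  have k: "k \<le> 2 * N" "b - 2 + k = 2 * N" using N b by auto
  have bk: "real b = 2 * real N + 2 - real k"
  proof -
    have "real (b + k) = real (2 * Suc N)" using N by (rule arg_cong)
    then show ?thesis by simp
  qed
  have absorb: "(real n - real k) * real (n choose k) = real n * real ((n - 1) choose k)" for n
  proof (cases "k \<le> n")
    case True
    have "real ((n - k) * (n choose k)) = real (n * ((n - 1) choose k))"
      by (simp only: binomial_absorb_comp)
    then show ?thesis using True by (simp add: of_nat_diff)
  qed (simp add: binomial_eq_0)
  define C where "C = real ((2 * N) choose k)"
  define C' where "C' = real ((2 * Suc N) choose k)"
  have C: "C > 0" "C' > 0" using k by (simp_all add: C_def C'_def)
  have CC: "C' * (real b * (real b - 1)) = (2 * real N + 2) * (2 * real N + 1) * C"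
  proof -
    have 1: "real b * C' = (2 * real N + 2) * real (Suc (2 * N) choose k)"
      using absorb[of "2 * Suc N"] by (simp add: C'_def bk add_ac)
    have 2: "(real b - 1) * real (Suc (2 * N) choose k) = (2 * real N + 1) * C"
      using absorb[of "Suc (2 * N)"] by (simp add: C_def bk add_ac diff_add_eq add_diff_eq)
    have "C' * (real b * (real b - 1)) = (real b * C') * (real b - 1)" by simp
    also have "\<dots> = (2 * real N + 2) * ((real b - 1) * real (Suc (2 * N) choose k))"
      unfolding 1 by simp
    finally show ?thesis unfolding 2 by simp
  qed
  define B where "B = real (N choose k)"
  define B' where "B' = real (Suc N choose k)"
  have BB: "B' * (real b - real k) = 2 * (real N + 1) * B"
    using absorb[of "Suc N"] by (simp add: B_def B'_def bk algebra_simps)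
  have mm: "moment (2 * Suc N) * (real b + real k + real DIM('a) - 2) = (2 * real N + 1) * moment (2 * N)"
    using moment_recurrence[of N] by (simp add: bk)
  have "funk_hecke_factor k b = moment (2 * Suc N) * B' * 2 ^ k / C'"
    using N by (simp add: funk_hecke_factor_def B'_def C'_def)
  then have "funk_hecke_factor k b * (real b - real k) * (real b + real k + real DIM('a) - 2) =
      (moment (2 * Suc N) * (real b + real k + real DIM('a) - 2)) * (B' * (real b - real k)) * 2 ^ k / C'"
    by simp
  also have "\<dots> = ((2 * real N + 2) * (2 * real N + 1) * C) * (moment (2 * N) * B * 2 ^ k) / (C' * C)"
    unfolding mm BB using C by (simp add: field_simps)
  also have "\<dots> = real b * (real b - 1) * (moment (2 * N) * B * 2 ^ k / C)"
    unfolding CC[symmetric] using C by simp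
  also have "moment (2 * N) * B * 2 ^ k / C = funk_hecke_factor k (b - 2)"
    using k by (simp add: funk_hecke_factor_def B_def C_def)
  finally show ?thesis .
qed

end

section \<open>Legendre polynomials\<close>

definition gegenbauer_integral :: "real \<Rightarrow> real poly \<Rightarrow> real" where
  "gegenbauer_integral \<alpha> q = (LBINT t:{-1..1}. poly q t * (1 - t\<^sup>2) powr \<alpha>)"

text \<open>
  The weight \<open>(1 - t\<^sup>2) powr \<alpha>\<close> times this operator is the Sturm-Liouville form
  \<open>((1 - t\<^sup>2) powr (\<alpha> + 1) * y')'\<close>. The Legendre polynomials of dimension \<open>m\<close> belong to
  \<open>\<alpha> = (m - 3) / 2\<close>.
\<close>

definition gegenbauer_operator :: "real \<Rightarrow> real poly \<Rightarrow> real poly" where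
  "gegenbauer_operator \<alpha> y = [:1, 0, -1:] * pderiv (pderiv y) - smult (2 * \<alpha> + 2) ([:0, 1:] * pderiv y)"

lemma abs_le_1_imp_power2_le_1: "t \<in> {-1..1} \<Longrightarrow> t\<^sup>2 \<le> (1::real)"
  by (auto simp: abs_square_le_1)

lemma continuous_on_gegenbauer_weight:
  "0 < \<alpha> \<Longrightarrow> continuous_on {-1..1} (\<lambda>t::real. (1 - t\<^sup>2) powr \<alpha>)"
  by (intro continuous_on_powr' continuous_intros) (auto simp: abs_le_1_imp_power2_le_1)

lemma continuous_on_gegenbauer_integrand:
  "0 < \<alpha> \<Longrightarrow> continuous_on {-1..1} (\<lambda>t::real. poly q t * (1 - t\<^sup>2) powr \<alpha>)"
  using continuous_on_poly[OF continuous_on_id, of _ q]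
  by (intro continuous_on_mult continuous_on_gegenbauer_weight) simp_all

lemma set_integrable_gegenbauer:
  "0 < \<alpha> \<Longrightarrow> set_integrable lborel {-1..1} (\<lambda>t::real. poly q t * (1 - t\<^sup>2) powr \<alpha>)"
  by (rule borel_integrable_atLeastAtMost'[OF continuous_on_gegenbauer_integrand])

lemma gegenbauer_integral_eq_integral:
  "0 < \<alpha> \<Longrightarrow> gegenbauer_integral \<alpha> q = integral {-1..1} (\<lambda>t. poly q t * (1 - t\<^sup>2) powr \<alpha>)"
  unfolding gegenbauer_integral_def
  by (rule set_borel_integral_eq_integral(2)[OF set_integrable_gegenbauer])

lemma gegenbauer_integral_0 [simp]: "gegenbauer_integral \<alpha> 0 = 0"
  by (simp add: gegenbauer_integral_def)

lemma gegenbauer_integral_smult: "gegenbauer_integral \<alpha> (smult c q) = c * gegenbauer_integral \<alpha> q"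
  by (simp add: gegenbauer_integral_def mult.assoc)

lemma gegenbauer_integral_add:
  "0 < \<alpha> \<Longrightarrow> gegenbauer_integral \<alpha> (p + q) = gegenbauer_integral \<alpha> p + gegenbauer_integral \<alpha> q"
  using set_integral_add(2)[OF set_integrable_gegenbauer[of \<alpha> p] set_integrable_gegenbauer[of \<alpha> q]]
  by (simp add: gegenbauer_integral_def distrib_right)

lemma gegenbauer_integral_diff:
  "0 < \<alpha> \<Longrightarrow> gegenbauer_integral \<alpha> (p - q) = gegenbauer_integral \<alpha> p - gegenbauer_integral \<alpha> q"
  using gegenbauer_integral_add[of \<alpha> p "smult (-1) q"] gegenbauer_integral_smult[of \<alpha> "-1" q] by simp

lemma gegenbauer_integral_sum:
  "0 < \<alpha> \<Longrightarrow> gegenbauer_integral \<alpha> (\<Sum>i\<in>I. q i) = (\<Sum>i\<in>I. gegenbauer_integral \<alpha> (q i))"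
  by (induction I rule: infinite_finite_induct) (simp_all add: gegenbauer_integral_add)

lemma gegenbauer_integral_square_eq_0_iff:
  assumes "0 < \<alpha>"
  shows "gegenbauer_integral \<alpha> (q * q) = 0 \<longleftrightarrow> q = 0"
proof
  assume "gegenbauer_integral \<alpha> (q * q) = 0"
  then have "integral {-1..1} (\<lambda>t. poly (q * q) t * (1 - t\<^sup>2) powr \<alpha>) = 0"
    using assms by (simp add: gegenbauer_integral_eq_integral)
  then have "\<forall>t\<in>{-1..1}. poly (q * q) t * (1 - t\<^sup>2) powr \<alpha> = 0"
    using continuous_on_gegenbauer_integrand[OF assms, of "q * q"]
    by (subst (asm) integral_eq_0_iff) auto
  moreover have "(1 - t\<^sup>2) powr \<alpha> \<noteq> 0" if "t \<in> {0<..<1}" for t :: real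
    using that by (auto simp: power2_eq_1_iff)
  ultimately have "{0<..<1} \<subseteq> {t. poly q t = 0}" by auto
  moreover have "infinite {0<..<1::real}" by simp
  ultimately have "infinite {t. poly q t = 0}" using finite_subset by blast
  then show "q = 0" using poly_roots_finite by blast
qed simp

text \<open>
  Together with the weight, the integrand is the derivative of \<open>q * (1 - t\<^sup>2) powr (\<alpha> + 1)\<close>, which
  vanishes at both ends.
\<close>

lemma gegenbauer_integral_by_parts:
  assumes \<alpha>: "0 < \<alpha>"
  shows "gegenbauer_integral \<alpha> ([:1, 0, -1:] * pderiv q - smult (2 * \<alpha> + 2) ([:0, 1:] * q)) = 0"
proof -
  let ?r = "[:1, 0, -1:] * pderiv q - smult (2 * \<alpha> + 2) ([:0, 1:] * q)"
  let ?F = "\<lambda>t. poly q t * (1 - t\<^sup>2) powr (\<alpha> + 1)"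
  have "((\<lambda>t. poly ?r t * (1 - t\<^sup>2) powr \<alpha>) has_integral (?F 1 - ?F (-1))) {-1..1}"
  proof (rule fundamental_theorem_of_calculus_interior)
    show "continuous_on {-1..1} ?F" using \<alpha> by (intro continuous_on_gegenbauer_integrand) simp
    fix t :: real assume "t \<in> {-1<..<1}"
    then have t: "0 < 1 - t\<^sup>2" by (simp add: abs_square_less_1 abs_less_iff)
    have "(?F has_real_derivative poly (pderiv q) t * (1 - t\<^sup>2) powr (\<alpha> + 1)
        + poly q t * ((\<alpha> + 1) * (1 - t\<^sup>2) powr \<alpha> * (- 2 * t))) (at t)"
      using t by (auto intro!: derivative_eq_intros)
    moreover have pw: "(1 - t\<^sup>2) powr (\<alpha> + 1) = (1 - t\<^sup>2) powr \<alpha> * (1 - t\<^sup>2)"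
      using t by (simp add: powr_add)
    have "poly (pderiv q) t * (1 - t\<^sup>2) powr (\<alpha> + 1)
        + poly q t * ((\<alpha> + 1) * (1 - t\<^sup>2) powr \<alpha> * (- 2 * t)) = poly ?r t * (1 - t\<^sup>2) powr \<alpha>"
      unfolding pw by (simp add: algebra_simps power2_eq_square)
    ultimately show "(?F has_vector_derivative poly ?r t * (1 - t\<^sup>2) powr \<alpha>) (at t)"
      by (simp add: has_real_derivative_iff_has_vector_derivative)
  qed simp
  then show ?thesis
    using \<alpha> by (simp only: gegenbauer_integral_eq_integral) (simp add: integral_unique)
qed

text \<open>
  Integration by parts for the Wronskian of \<open>y\<close> and \<open>z\<close>.
\<close>

lemma gegenbauer_operator_symmetric:
  assumes \<alpha>: "0 < \<alpha>"
  shows "gegenbauer_integral \<alpha> (gegenbauer_operator \<alpha> y * z) = gegenbauer_integral \<alpha> (y * gegenbauer_operator \<alpha> z)"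
proof -
  let ?q = "pderiv y * z - y * pderiv z"
  have "gegenbauer_operator \<alpha> y * z - y * gegenbauer_operator \<alpha> z =
      [:1, 0, -1:] * pderiv ?q - smult (2 * \<alpha> + 2) ([:0, 1:] * ?q)"
    unfolding poly_eq_poly_eq_iff[symmetric]
    by (rule ext) (simp add: gegenbauer_operator_def pderiv_diff pderiv_mult algebra_simps)
  then have "gegenbauer_integral \<alpha> (gegenbauer_operator \<alpha> y * z - y * gegenbauer_operator \<alpha> z) = 0"
    using gegenbauer_integral_by_parts[OF \<alpha>] by simp
  then show ?thesis using \<alpha> by (simp add: gegenbauer_integral_diff)
qed

lemma coeff_gegenbauer_operator:
  "coeff (gegenbauer_operator \<alpha> y) i =
     (real i + 2) * (real i + 1) * coeff y (i + 2) - real i * (real i + 2 * \<alpha> + 1) * coeff y i"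
proof -
  have "[:1, 0, -1:] * q = q + pCons 0 (pCons 0 (- q))" for q :: "real poly" by simp
  then show ?thesis
    unfolding gegenbauer_operator_def
    by (simp add: coeff_pCons coeff_pderiv split: nat.splits) (auto simp: algebra_simps)
qed

lemma legendre_poly_orthogonal:
  assumes "legendre_poly m k p" "degree q < k"
  shows "gegenbauer_integral ((real m - 3) / 2) (p * q) = 0"
  using assms by (simp add: legendre_poly_def gegenbauer_integral_def)

text \<open>
  The left-hand side has degree below \<open>k\<close>, since the factor is chosen to cancel the leading
  coefficient. By symmetry of the operator it is orthogonal to all polynomials of degree below \<open>k\<close>,
  in particular to itself.
\<close>

lemma legendre_poly_differential_equation:
  assumes m: "3 < m" and p: "legendre_poly m k p" and \<alpha>: "\<alpha> = (real m - 3) / 2"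
  shows "gegenbauer_operator \<alpha> p + smult (real k * (real k + 2 * \<alpha> + 1)) p = 0" (is "?r = 0")
proof (rule ccontr)
  assume r: "?r \<noteq> 0"
  have \<alpha>0: "0 < \<alpha>" using m \<alpha> by simp
  let ?L = "\<lambda>y. gegenbauer_operator \<alpha> y + smult (real k * (real k + 2 * \<alpha> + 1)) y"
  have deg: "degree p = k" using p by (simp add: legendre_poly_def)
  have "coeff ?r i = 0" if "k \<le> i" for i
    using that deg by (cases "i = k") (simp_all add: coeff_gegenbauer_operator coeff_eq_0)
  then have degr: "degree ?r < k" using r by (metis leading_coeff_0_iff not_le)
  have "coeff (?L ?r) i = 0" if "degree ?r < i" for i
  proof -
    have "coeff ?r i = 0" "coeff ?r (i + 2) = 0" using that by (simp_all add: coeff_eq_0 del: coeff_add)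
    then show ?thesis unfolding coeff_add coeff_smult[of _ ?r] coeff_gegenbauer_operator[of _ ?r] by simp
  qed
  then have "degree (?L ?r) \<le> degree ?r" by (rule degree_le[rule_format]) 
  then have "degree (?L ?r) < k" using degr by (rule le_less_trans)
  then have "gegenbauer_integral \<alpha> (p * ?L ?r) = 0"
    by (rule legendre_poly_orthogonal[OF p, folded \<alpha>])
  moreover have "gegenbauer_integral \<alpha> (?L p * z) = gegenbauer_integral \<alpha> (p * ?L z)" for z
    using gegenbauer_operator_symmetric[OF \<alpha>0, of p z] \<alpha>0
    by (simp add: gegenbauer_integral_add gegenbauer_integral_smult distrib_left distrib_right)
  ultimately have "gegenbauer_integral \<alpha> (?r * ?r) = 0" by simp
  then show False using gegenbauer_integral_square_eq_0_iff[OF \<alpha>0] r by simp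
qed

lemma legendre_poly_moment_less:
  assumes "legendre_poly m k p" "b < k"
  shows "gegenbauer_integral ((real m - 3) / 2) (p * monom 1 b) = 0"
  using assms by (intro legendre_poly_orthogonal) (simp_all add: degree_monom_eq)

text \<open>
  The differential equation of \<open>p\<close>, tested against \<open>t ^ b\<close>. For \<open>b < 2\<close> the truncated exponent
  \<open>b - 2\<close> is harmless because of the factor \<open>b * (b - 1)\<close>.
\<close>

lemma legendre_poly_moment_recurrence:
  assumes m: "3 < m" and p: "legendre_poly m k p" and \<alpha>: "\<alpha> = (real m - 3) / 2"
  shows "gegenbauer_integral \<alpha> (p * monom 1 b) * (real b - real k) * (real b + real k + 2 * \<alpha> + 1) =
    real b * (real b - 1) * gegenbauer_integral \<alpha> (p * monom 1 (b - 2))"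
proof -
  let ?c = "real k * (real k + 2 * \<alpha> + 1)" and ?I = "gegenbauer_integral \<alpha>"
  have \<alpha>0: "0 < \<alpha>" using m \<alpha> by simp
  have "gegenbauer_operator \<alpha> (monom 1 b) =
      smult (real b * (real b - 1)) (monom 1 (b - 2)) - smult (real b * (real b + 2 * \<alpha> + 1)) (monom 1 b)"
  proof (rule poly_eqI)
    fix i
    show "coeff (gegenbauer_operator \<alpha> (monom 1 b)) i = coeff (smult (real b * (real b - 1)) (monom 1 (b - 2))
        - smult (real b * (real b + 2 * \<alpha> + 1)) (monom 1 b)) i"
      by (cases "b = 0 \<or> b = 1") (auto simp: coeff_gegenbauer_operator of_nat_diff algebra_simps)
  qed
  then have "real b * (real b - 1) * ?I (p * monom 1 (b - 2)) - real b * (real b + 2 * \<alpha> + 1) * ?I (p * monom 1 b) =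
      ?I (p * gegenbauer_operator \<alpha> (monom 1 b))"
    using \<alpha>0 by (simp add: right_diff_distrib gegenbauer_integral_diff gegenbauer_integral_smult)
  also have "\<dots> = ?I (gegenbauer_operator \<alpha> p * monom 1 b)"
    by (rule gegenbauer_operator_symmetric[OF \<alpha>0, symmetric])
  also have "gegenbauer_operator \<alpha> p = smult (- ?c) p"
    using legendre_poly_differential_equation[OF m p \<alpha>] by (simp add: eq_neg_iff_add_eq_0)
  also have "?I (smult (- ?c) p * monom 1 b) = - ?c * ?I (p * monom 1 b)"
    by (simp only: mult_smult_left gegenbauer_integral_smult)
  finally show ?thesis by (simp add: algebra_simps)
qed

text \<open>
  Otherwise \<open>p\<close> would be orthogonal to all polynomials of degree at most \<open>k\<close>, and so to itself.
\<close>

lemma legendre_poly_moment_diag: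
  assumes m: "3 < m" and p: "legendre_poly m k p"
  shows "gegenbauer_integral ((real m - 3) / 2) (p * monom 1 k) \<noteq> 0"
proof
  let ?I = "gegenbauer_integral ((real m - 3) / 2)"
  have \<alpha>: "0 < (real m - 3) / 2" using m by simp
  assume 0: "?I (p * monom 1 k) = 0"
  have deg: "degree p = k" "p \<noteq> 0" using p by (simp_all add: legendre_poly_def)
  define q where "q = p - smult (lead_coeff p) (monom 1 k)"
  have "coeff q i = 0" if "k \<le> i" for i
    using that deg by (cases "i = k") (simp_all add: q_def coeff_eq_0)
  then have "q = 0 \<or> degree q < k" by (metis leading_coeff_0_iff not_le)
  then have "?I (p * q) = 0" using legendre_poly_orthogonal[OF p] by auto
  moreover have "?I (p * p) = ?I (p * q) + lead_coeff p * ?I (p * monom 1 k)"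
    using \<alpha> by (simp add: q_def right_diff_distrib gegenbauer_integral_diff gegenbauer_integral_smult)
  ultimately have "?I (p * p) = 0" using 0 by simp
  then show False using gegenbauer_integral_square_eq_0_iff[OF \<alpha>] deg by simp
qed

lemma recurrence_unique_up_to_factor:
  fixes f g :: "nat \<Rightarrow> real" and n :: real
  assumes k: "1 \<le> k" and n: "0 < n"
    and f: "\<And>b. b < k \<Longrightarrow> f b = 0"
      "\<And>b. 2 \<le> b \<Longrightarrow> f b * (real b - real k) * (real b + real k + n - 2) = real b * (real b - 1) * f (b - 2)"
    and g: "\<And>b. b < k \<Longrightarrow> g b = 0"
      "\<And>b. 2 \<le> b \<Longrightarrow> g b * (real b - real k) * (real b + real k + n - 2) = real b * (real b - 1) * g (b - 2)"
    and gk: "g k \<noteq> 0"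
  shows "f b = f k / g k * g b"
proof (induction b rule: less_induct)
  case (less b)
  consider "b < k" | "b = k" | "k < b" by linarith
  then show ?case
  proof cases
    case 3
    then have b: "2 \<le> b" using k by simp
    have nz: "real b - real k \<noteq> 0" "real b + real k + n - 2 \<noteq> 0" using 3 b n k by linarith+
    have "f b * (real b - real k) * (real b + real k + n - 2) = real b * (real b - 1) * (f k / g k * g (b - 2))"
      using f(2)[OF b] less.IH[of "b - 2"] b by simp
    also have "\<dots> = f k / g k * (real b * (real b - 1) * g (b - 2))" by simp
    also have "\<dots> = (f k / g k * g b) * (real b - real k) * (real b + real k + n - 2)"
      unfolding g(2)[OF b, symmetric] by simp
    finally show ?thesis by (simp only: mult_right_cancel[OF nz(1)] mult_right_cancel[OF nz(2)])
  qed (use f g gk in auto)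
qed

section \<open>The Funk-Hecke formula for polynomials and continuous densities\<close>

lemma pderiv_sum: "pderiv (\<Sum>i\<in>I. q i) = (\<Sum>i\<in>I. pderiv (q i))"
  by (induction I rule: infinite_finite_induct) (simp_all add: pderiv_add)

lemma exists_poly_antiderivative:
  fixes q :: "real poly"
  shows "\<exists>Q. pderiv Q = q \<and> poly Q (-1) = 0"
proof -
  define Q0 where "Q0 = (\<Sum>i\<le>degree q. monom (coeff q i / real (Suc i)) (Suc i))"
  have "pderiv Q0 = (\<Sum>i\<le>degree q. monom (coeff q i) i)"
    by (simp add: Q0_def pderiv_sum pderiv_monom del: of_nat_Suc)
  then have "pderiv Q0 = q" by (simp add: poly_as_sum_of_monoms)
  then show ?thesis
    by (intro exI[of _ "Q0 - [:poly Q0 (-1):]"]) (simp add: pderiv_diff pderiv_pCons)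
qed

lemma poly_approximation:
  fixes f :: "real \<Rightarrow> real"
  assumes "continuous_on {a..b} f" "0 < e"
  shows "\<exists>q. \<forall>t\<in>{a..b}. \<bar>f t - poly q t\<bar> < e"
proof -
  obtain g where g: "real_polynomial_function g" "\<And>t. t \<in> {a..b} \<Longrightarrow> \<bar>f t - g t\<bar> < e"
    using Stone_Weierstrass_real_polynomial_function[of "{a..b}" f e] assms by auto
  then obtain c n where "g = (\<lambda>t. \<Sum>i\<le>n. c i * t ^ i)"
    by (auto simp: real_polynomial_function_iff_sum)
  then have "g t = poly (\<Sum>i\<le>n. monom (c i) i) t" for t by (simp add: poly_sum poly_monom)
  then show ?thesis using g(2) by (intro exI[of _ "\<Sum>i\<le>n. monom (c i) i"]) auto
qed

lemma continuous_on_clamped_integral: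
  fixes \<phi> :: "real \<Rightarrow> real"
  assumes "continuous_on {-1..1} \<phi>"
  shows "continuous_on UNIV (\<lambda>t. integral {-1..max (-1) (min 1 t)} \<phi>)"
proof (rule continuous_on_compose2[of "{-1..1}" "\<lambda>t. integral {-1..t} \<phi>"])
  show "continuous_on {-1..1} (\<lambda>t. integral {-1..t} \<phi>)"
    using assms by (intro indefinite_integral_continuous_1 integrable_continuous_interval)
qed (auto intro!: continuous_intros)

text \<open>
  For orthonormal \<open>e1\<close>, \<open>e2\<close> a harmonic polynomial, homogeneous of degree \<open>k\<close> and bounded by 1 on
  the sphere, so that it can perturb a probability density.
\<close>

definition plane_harmonic :: "nat \<Rightarrow> 'a::euclidean_space \<Rightarrow> 'a \<Rightarrow> 'a \<Rightarrow> real" where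
  "plane_harmonic k e1 e2 x = Re (plane_coord e1 e2 x ^ k)"

lemma continuous_plane_harmonic [continuous_intros]: "continuous_on S (plane_harmonic k e1 e2)"
  unfolding plane_harmonic_def by (intro continuous_intros)

lemma abs_plane_harmonic_le:
  assumes e: "norm e1 = 1" "norm e2 = 1" "e1 \<bullet> e2 = 0"
  shows "\<bar>plane_harmonic k e1 e2 x\<bar> \<le> norm x ^ k"
proof -
  have ee: "e1 \<bullet> e1 = 1" "e2 \<bullet> e2 = 1" using e by (simp_all add: norm_eq_1)
  define y where "y = x - (x \<bullet> e1) *\<^sub>R e1 - (x \<bullet> e2) *\<^sub>R e2"
  have "0 \<le> y \<bullet> y" by simp
  also have "y \<bullet> y = x \<bullet> x - (x \<bullet> e1)\<^sup>2 - (x \<bullet> e2)\<^sup>2"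
    using e ee by (simp add: y_def inner_diff_left inner_diff_right inner_commute[of e1 x]
        inner_commute[of e2 x] inner_commute[of e2 e1] power2_eq_square algebra_simps)
  finally have "(x \<bullet> e1)\<^sup>2 + (x \<bullet> e2)\<^sup>2 \<le> (norm x)\<^sup>2" by (simp add: power2_norm_eq_inner)
  then have "cmod (plane_coord e1 e2 x) \<le> norm x"
    by (simp add: plane_coord_def complex_norm real_le_lsqrt)
  then have "cmod (plane_coord e1 e2 x ^ k) \<le> norm x ^ k"
    by (simp add: norm_power power_mono)
  then show ?thesis unfolding plane_harmonic_def using abs_Re_le_cmod order_trans by blast
qed

context rotation_invariant_sphere_measure
begin

lemma funk_hecke_monomial_Re:
  assumes u: "norm u = 1" and e: "norm e1 = 1" "norm e2 = 1" "e1 \<bullet> e2 = 0"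
  shows "(\<integral>x. (x \<bullet> u) ^ a * plane_harmonic k e1 e2 x \<partial>P) = funk_hecke_factor k a * plane_harmonic k e1 e2 u"
proof -
  have int: "integrable P (\<lambda>x. of_real (x \<bullet> u) ^ a * plane_coord e1 e2 x ^ k)"
    by (intro integrable_continuous continuous_intros)
  have Re: "Re (of_real (x \<bullet> u) ^ a * plane_coord e1 e2 x ^ k) = (x \<bullet> u) ^ a * plane_harmonic k e1 e2 x" for x
    unfolding of_real_power[symmetric] by (simp add: plane_harmonic_def)
  have "(\<integral>x. (x \<bullet> u) ^ a * plane_harmonic k e1 e2 x \<partial>P) =
      Re (\<integral>x. of_real (x \<bullet> u) ^ a * plane_coord e1 e2 x ^ k \<partial>P)"
    unfolding Re[symmetric] by (rule integral_Re[OF int])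
  then show ?thesis by (simp add: funk_hecke_monomial[OF u e] plane_harmonic_def)
qed

text \<open>
  The factor \<open>a * t ^ (a - 1)\<close> is the derivative of \<open>t ^ a\<close>: the eigenvalue of a zonal kernel is
  obtained by integrating the derivative of the kernel against the Legendre polynomial of degree one
  less in dimension \<open>n + 2\<close>. Both sides obey the same recurrence and vanish for \<open>a \<le> K\<close>, so they
  agree up to the ratio of their values at \<open>a = K + 1\<close>.
\<close>

lemma funk_hecke_factor_eq_legendre_moment:
  assumes n: "2 \<le> DIM('a)" and p: "legendre_poly (DIM('a) + 2) K p"
    and \<alpha>: "\<alpha> = (real (DIM('a) + 2) - 3) / 2"
  shows "\<exists>\<gamma>. \<forall>a. funk_hecke_factor (Suc K) a = \<gamma> * (real a * gegenbauer_integral \<alpha> (p * monom 1 (a - 1)))"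
proof -
  let ?g = "\<lambda>a. real a * gegenbauer_integral \<alpha> (p * monom 1 (a - 1))"
  have m: "3 < DIM('a) + 2" using n by simp
  have \<alpha>n: "2 * \<alpha> + 1 = real DIM('a)" by (simp add: \<alpha> field_simps)
  have "funk_hecke_factor (Suc K) b = funk_hecke_factor (Suc K) (Suc K) / ?g (Suc K) * ?g b" for b
  proof (rule recurrence_unique_up_to_factor[where n="real DIM('a)"])
    show "?g b = 0" if "b < Suc K" for b
      using legendre_poly_moment_less[OF p, of "b - 1"] that by (cases b) (simp_all add: \<alpha>)
    show "?g b * (real b - real (Suc K)) * (real b + real (Suc K) + real DIM('a) - 2) =
        real b * (real b - 1) * ?g (b - 2)" if "2 \<le> b" for b
    proof -
      define c where "c = b - 2"
      have c: "b = Suc (Suc c)" using that by (simp add: c_def)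
      show ?thesis
        using legendre_poly_moment_recurrence[OF m p \<alpha>, of "Suc c"]
        by (simp add: c flip: \<alpha>n) (simp add: algebra_simps)
    qed
    show "?g (Suc K) \<noteq> 0"
      using legendre_poly_moment_diag[OF m p] by (simp add: \<alpha>)
    show "funk_hecke_factor (Suc K) b * (real b - real (Suc K)) * (real b + real (Suc K) + real DIM('a) - 2) =
        real b * (real b - 1) * funk_hecke_factor (Suc K) (b - 2)" if "2 \<le> b" for b
      using that by (rule funk_hecke_factor_recurrence)
  qed (use n in \<open>simp_all add: funk_hecke_factor_less\<close>)
  then show ?thesis by blast
qed

lemma funk_hecke_poly:
  assumes n: "2 \<le> DIM('a)" and p: "legendre_poly (DIM('a) + 2) K p"
    and \<alpha>: "\<alpha> = (real (DIM('a) + 2) - 3) / 2" and e: "norm e1 = 1" "norm e2 = 1" "e1 \<bullet> e2 = 0"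
  shows "\<exists>\<gamma>. \<forall>g u. norm u = 1 \<longrightarrow> (\<integral>x. poly g (x \<bullet> u) * plane_harmonic (Suc K) e1 e2 x \<partial>P) =
    \<gamma> * gegenbauer_integral \<alpha> (p * pderiv g) * plane_harmonic (Suc K) e1 e2 u"
proof -
  have \<alpha>0: "0 < \<alpha>" using n by (simp add: \<alpha>)
  obtain \<gamma> where \<gamma>: "\<And>a. funk_hecke_factor (Suc K) a = \<gamma> * (real a * gegenbauer_integral \<alpha> (p * monom 1 (a - 1)))"
    using funk_hecke_factor_eq_legendre_moment[OF n p \<alpha>] by blast
  have "(\<integral>x. poly g (x \<bullet> u) * plane_harmonic (Suc K) e1 e2 x \<partial>P) =
      \<gamma> * gegenbauer_integral \<alpha> (p * pderiv g) * plane_harmonic (Suc K) e1 e2 u" if u: "norm u = 1" for g u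
  proof -
    let ?h = "plane_harmonic (Suc K) e1 e2"
    have int: "integrable P (\<lambda>x. (x \<bullet> u) ^ a * ?h x)" for a
      by (intro integrable_continuous continuous_intros)
    have "(\<integral>x. poly g (x \<bullet> u) * ?h x \<partial>P) = (\<integral>x. (\<Sum>a\<le>degree g. coeff g a * ((x \<bullet> u) ^ a * ?h x)) \<partial>P)"
      by (simp add: poly_altdef sum_distrib_right mult.assoc)
    also have "\<dots> = (\<Sum>a\<le>degree g. coeff g a * (funk_hecke_factor (Suc K) a * ?h u))"
      using int by (simp add: funk_hecke_monomial_Re[OF u e])
    also have "\<dots> = \<gamma> * (\<Sum>a\<le>degree g. gegenbauer_integral \<alpha> (p * smult (coeff g a * real a) (monom 1 (a - 1)))) * ?h u"
      by (simp add: \<gamma> gegenbauer_integral_smult sum_distrib_left sum_distrib_right mult_ac)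
    also have "(\<Sum>a\<le>degree g. gegenbauer_integral \<alpha> (p * smult (coeff g a * real a) (monom 1 (a - 1)))) =
        gegenbauer_integral \<alpha> (p * pderiv (\<Sum>a\<le>degree g. monom (coeff g a) a))"
      using \<alpha>0 by (simp add: gegenbauer_integral_sum[symmetric] sum_distrib_left pderiv_sum pderiv_monom
          smult_monom mult.commute)
    finally show ?thesis by (simp add: poly_as_sum_of_monoms)
  qed
  then show ?thesis by blast
qed

text \<open>
  The identity for polynomial kernels passes to kernels with continuous derivative \<open>\<phi>\<close>: approximate
  \<open>\<phi>\<close> uniformly by polynomials; their antiderivatives then approximate the kernel. The kernel is
  clamped outside \<open>[-1,1]\<close> to be continuous on the whole line; on the sphere \<open>x \<bullet> u\<close> stays in the
  interval.
\<close>

lemma funk_hecke_continuous: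
  assumes \<phi>: "continuous_on {-1..1} \<phi>" and u: "norm u = 1" and \<alpha>: "0 < \<alpha>"
    and h: "continuous_on UNIV h" "\<And>x. norm x = 1 \<Longrightarrow> \<bar>h x\<bar> \<le> 1"
    and poly: "\<And>g. (\<integral>x. poly g (x \<bullet> u) * h x \<partial>P) = c * gegenbauer_integral \<alpha> (p * pderiv g)"
  shows "(\<integral>x. integral {-1..max (-1) (min 1 (x \<bullet> u))} \<phi> * h x \<partial>P) =
    c * integral {-1..1} (\<lambda>t. \<phi> t * (poly p t * (1 - t\<^sup>2) powr \<alpha>))"
proof -
  let ?W = "\<lambda>t. poly p t * (1 - t\<^sup>2) powr \<alpha>"
  let ?G = "\<lambda>t. integral {-1..max (-1) (min 1 t)} \<phi>"
  let ?lhs = "\<integral>x. ?G (x \<bullet> u) * h x \<partial>P" and ?rhs = "c * integral {-1..1} (\<lambda>t. \<phi> t * ?W t)"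
  have W: "continuous_on {-1..1} ?W" by (rule continuous_on_gegenbauer_integrand[OF \<alpha>])
  obtain B where B': "\<forall>y\<in>?W ` {-1..1}. norm y \<le> B"
    using compact_imp_bounded[OF compact_continuous_image[OF W compact_Icc]] bounded_iff by blast
  have B: "\<bar>?W t\<bar> \<le> B" if "t \<in> {-1..1}" for t using bspec[OF B' imageI[OF that]] by simp
  have B0: "0 \<le> B" using B[of 0] by simp
  have "\<bar>?lhs - ?rhs\<bar> \<le> (2 + \<bar>c\<bar> * (2 * B)) * \<epsilon>" if \<epsilon>: "0 < \<epsilon>" for \<epsilon>
  proof -
    obtain q where q: "\<And>t. t \<in> {-1..1} \<Longrightarrow> \<bar>\<phi> t - poly q t\<bar> < \<epsilon>"
      using poly_approximation[OF \<phi> \<epsilon>] by blast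
    obtain Q where Q: "pderiv Q = q" "poly Q (-1) = 0" using exists_poly_antiderivative by blast
    have qcont: "continuous_on S (poly q)" for S
      using continuous_on_poly[OF continuous_on_id, of S q] by simp
    have close: "\<bar>?G (x \<bullet> u) - poly Q (x \<bullet> u)\<bar> \<le> 2 * \<epsilon>" if x: "norm x = 1" for x
    proof -
      define t where "t = x \<bullet> u"
      have t: "t \<in> {-1..1}" using Cauchy_Schwarz_ineq2[of x u] x u by (auto simp: t_def abs_le_iff)
      have "(poly q has_integral (poly Q t - poly Q (-1))) {-1..t}"
        using t Q(1) by (intro fundamental_theorem_of_calculus)
          (auto simp: has_real_derivative_iff_has_vector_derivative[symmetric]
            intro!: has_field_derivative_at_within poly_DERIV)
      then have Qt: "poly Q t = integral {-1..t} (poly q)" using Q(2) by (simp add: integral_unique)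
      have "?G t = integral {-1..t} \<phi>" using t by (simp add: max_absorb2 min_absorb2)
      then have "?G t - poly Q t = integral {-1..t} (\<lambda>r. \<phi> r - poly q r)"
        unfolding Qt using t continuous_on_subset[OF \<phi>, of "{-1..t}"] qcont
        by (simp add: Henstock_Kurzweil_Integration.integral_diff integrable_continuous_interval)
      also have "norm \<dots> \<le> \<epsilon> * (t - (-1))"
        using t q continuous_on_subset[OF \<phi>, of "{-1..t}"] qcont
        by (intro integral_bound) (auto intro!: continuous_intros less_imp_le)
      also have "\<dots> \<le> \<epsilon> * 2" using t \<epsilon> by (intro mult_left_mono) auto
      finally show ?thesis by (simp add: t_def mult.commute)
    qed
    have intG: "integrable P (\<lambda>x. ?G (x \<bullet> u) * h x)"
    proof (rule integrable_continuous, rule continuous_on_mult)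
      show "continuous_on UNIV (\<lambda>x. ?G (x \<bullet> u))"
        by (rule continuous_on_compose2[OF continuous_on_clamped_integral[OF \<phi>]])
          (auto intro!: continuous_intros)
    qed (rule h(1))
    have intQ: "integrable P (\<lambda>x. poly Q (x \<bullet> u) * h x)"
      using h(1) by (intro integrable_continuous continuous_intros)
    have "?lhs - c * gegenbauer_integral \<alpha> (p * q) =
        (\<integral>x. ?G (x \<bullet> u) * h x - poly Q (x \<bullet> u) * h x \<partial>P)"
      using intG intQ poly[of Q] Q(1) by simp
    also have "\<bar>\<dots>\<bar> \<le> (\<integral>x. 2 * \<epsilon> \<partial>P)"
    proof (rule integral_abs_bound[THEN order_trans], rule integral_mono_AE)
      show "AE x in P. \<bar>?G (x \<bullet> u) * h x - poly Q (x \<bullet> u) * h x\<bar> \<le> 2 * \<epsilon>"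
        using AE_sphere
      proof eventually_elim
        case (elim x)
        then have "\<bar>?G (x \<bullet> u) - poly Q (x \<bullet> u)\<bar> * \<bar>h x\<bar> \<le> (2 * \<epsilon>) * 1"
          using \<epsilon> h(2)[of x] close[of x] by (intro mult_mono) auto
        then show ?case by (simp add: left_diff_distrib[symmetric] abs_mult)
      qed
    qed (use intG intQ in auto)
    finally have 1: "\<bar>?lhs - c * gegenbauer_integral \<alpha> (p * q)\<bar> \<le> 2 * \<epsilon>" by (simp add: prob_space)
    have "gegenbauer_integral \<alpha> (p * q) = integral {-1..1} (\<lambda>t. poly q t * ?W t)"
      using \<alpha> by (simp add: gegenbauer_integral_eq_integral mult_ac)
    then have "integral {-1..1} (\<lambda>t. \<phi> t * ?W t) - gegenbauer_integral \<alpha> (p * q) =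
        integral {-1..1} (\<lambda>t. \<phi> t * ?W t - poly q t * ?W t)"
      using \<phi> W qcont by (simp add: Henstock_Kurzweil_Integration.integral_diff integrable_continuous_interval continuous_on_mult)
    also have "norm \<dots> \<le> (\<epsilon> * B) * (1 - (-1))"
    proof (rule integral_bound)
      show "norm (\<phi> t * ?W t - poly q t * ?W t) \<le> \<epsilon> * B" if "t \<in> {-1..1}" for t
      proof -
        have "\<bar>\<phi> t - poly q t\<bar> * \<bar>?W t\<bar> \<le> \<epsilon> * B"
          using q[OF that] B[OF that] \<epsilon> by (intro mult_mono) auto
        then show ?thesis by (simp add: left_diff_distrib[symmetric] abs_mult)
      qed
    qed (use \<phi> W qcont in \<open>auto intro!: continuous_on_mult continuous_on_diff\<close>)
    finally have "\<bar>c\<bar> * \<bar>integral {-1..1} (\<lambda>t. \<phi> t * ?W t) - gegenbauer_integral \<alpha> (p * q)\<bar> \<le> \<bar>c\<bar> * (2 * B * \<epsilon>)"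
      by (intro mult_left_mono) (simp_all add: mult_ac)
    then have "\<bar>?rhs - c * gegenbauer_integral \<alpha> (p * q)\<bar> \<le> \<bar>c\<bar> * (2 * B) * \<epsilon>"
      by (simp add: right_diff_distrib[symmetric] abs_mult mult_ac)
    then show ?thesis using 1 by (simp add: distrib_right)
  qed
  then have "\<bar>?lhs - ?rhs\<bar> \<le> 0"
  proof -
    let ?C = "2 + \<bar>c\<bar> * (2 * B)"
    assume *: "\<And>\<epsilon>. 0 < \<epsilon> \<Longrightarrow> \<bar>?lhs - ?rhs\<bar> \<le> ?C * \<epsilon>"
    have C: "0 < ?C" using B0 by (simp add: add_pos_nonneg)
    show ?thesis
    proof (rule field_le_epsilon)
      fix e :: real assume "0 < e"
      then show "\<bar>?lhs - ?rhs\<bar> \<le> 0 + e" using *[of "e / ?C"] C by simp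
    qed
  qed
  then show ?thesis by simp
qed

end

section \<open>Caps and circles of latitude\<close>

lemma exists_bump:
  fixes a b :: real
  assumes "-1 \<le> a" "a < b" "b \<le> 1"
  shows "\<exists>\<phi>::real \<Rightarrow> real. continuous_on {-1..1} \<phi> \<and> (\<forall>t. 0 \<le> \<phi> t) \<and> (\<forall>t. t \<notin> {a<..<b} \<longrightarrow> \<phi> t = 0) \<and>
    integral {-1..1} \<phi> = 1"
proof -
  define f where "f t = max 0 ((t - a) * (b - t))" for t
  have cont: "continuous_on {-1..1} f" unfolding f_def by (intro continuous_intros)
  have f0: "0 \<le> f t" for t by (simp add: f_def)
  have "0 < ((a + b) / 2 - a) * (b - (a + b) / 2)"
    using assms by (intro mult_pos_pos) (simp_all add: field_simps)
  then have "f ((a + b) / 2) > 0" by (simp add: f_def)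
  then have "integral {-1..1} f \<noteq> 0"
    using assms f0 cont by (subst integral_eq_0_iff) (auto intro!: bexI[of _ "(a + b) / 2"])
  moreover have "0 \<le> integral {-1..1} f" using f0 cont by (intro integral_nonneg integrable_continuous_interval)
  ultimately have I: "0 < integral {-1..1} f" by simp
  have zero: "f t = 0" if "t \<notin> {a<..<b}" for t
  proof -
    have "(t - a) * (b - t) \<le> 0"
      using that assms by (auto simp: not_less mult_le_0_iff)
    then show ?thesis by (simp add: f_def)
  qed
  show ?thesis
    using I f0 zero cont
    by (intro exI[of _ "\<lambda>t. f t / integral {-1..1} f"]) (auto intro!: continuous_intros)
qed

lemma integral_clamped_bump:
  fixes a b :: real and \<phi> :: "real \<Rightarrow> real"
  assumes \<phi>: "continuous_on {-1..1} \<phi>" "\<And>t. 0 \<le> \<phi> t" "\<And>t. t \<notin> {a<..<b} \<Longrightarrow> \<phi> t = 0"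
    "integral {-1..1} \<phi> = 1" and ab: "-1 \<le> a" "a < b" "b \<le> 1"
  defines "G \<equiv> \<lambda>t. integral {-1..max (-1) (min 1 t)} \<phi>"
  shows "0 \<le> G t" "G t \<le> 1" "b \<le> t \<Longrightarrow> G t = 1" "t \<le> a \<Longrightarrow> G t = 0"
proof -
  define c where "c = max (-1) (min 1 t)"
  have c: "-1 \<le> c" "c \<le> 1" by (auto simp: c_def)
  have int: "\<phi> integrable_on {x..y}" if "-1 \<le> x" "y \<le> 1" for x y
    using that by (intro integrable_continuous_interval continuous_on_subset[OF \<phi>(1)]) auto
  have G: "G t = integral {-1..c} \<phi>" by (simp add: G_def c_def)
  have nonneg: "0 \<le> integral {x..y} \<phi>" if "-1 \<le> x" "y \<le> 1" for x y
    using \<phi>(2) int[OF that] by (intro integral_nonneg)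
  have split: "G t + integral {c..1} \<phi> = 1"
    using Henstock_Kurzweil_Integration.integral_combine[OF c int[OF order_refl order_refl]]
    by (simp add: G \<phi>(4))
  show "0 \<le> G t" unfolding G using c by (intro nonneg) auto
  show "G t \<le> 1" using split nonneg[OF c(1) order_refl] by linarith
  show "G t = 1" if "b \<le> t"
  proof -
    have "b \<le> c" using that ab by (auto simp: c_def)
    then have "integral {c..1} \<phi> = integral {c..1} (\<lambda>_. 0)"
      by (intro Henstock_Kurzweil_Integration.integral_cong) (auto intro!: \<phi>(3))
    then show ?thesis using split by simp
  qed
  show "G t = 0" if "t \<le> a"
  proof -
    have "c \<le> a" using that ab by (auto simp: c_def)
    then have "integral {-1..c} \<phi> = integral {-1..c} (\<lambda>_. 0)"
      by (intro Henstock_Kurzweil_Integration.integral_cong) (auto intro!: \<phi>(3))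
    then show ?thesis by (simp add: G)
  qed
qed

text \<open>
  Bumps of mass 1 with supports shrinking to \<open>s\<close> act like a point mass at \<open>s\<close>, where \<open>W\<close> vanishes.
\<close>

lemma integral_bump_mult_tendsto_0:
  fixes W :: "real \<Rightarrow> real" and a :: "nat \<Rightarrow> real" and \<phi> :: "nat \<Rightarrow> real \<Rightarrow> real"
  assumes W: "continuous_on {-1..1} W" "W s = 0" and s: "s \<in> {-1..1}" and a: "a \<longlonglongrightarrow> s" "\<And>j. -1 \<le> a j"
    and \<phi>: "\<And>j. continuous_on {-1..1} (\<phi> j)" "\<And>j t. 0 \<le> \<phi> j t" "\<And>j t. t \<notin> {a j<..<s} \<Longrightarrow> \<phi> j t = 0"
      "\<And>j. integral {-1..1} (\<phi> j) = 1"
  shows "(\<lambda>j. integral {-1..1} (\<lambda>t. \<phi> j t * W t)) \<longlonglongrightarrow> 0"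
proof (rule tendstoI)
  fix \<epsilon> :: real assume "0 < \<epsilon>"
  then obtain d where d: "0 < d" "\<And>t. t \<in> {-1..1} \<Longrightarrow> dist t s < d \<Longrightarrow> dist (W t) (W s) < \<epsilon> / 2"
    using W(1) s unfolding continuous_on_iff by (meson half_gt_zero)
  have "\<forall>\<^sub>F j in sequentially. dist (a j) s < d" using a(1) d(1) by (rule tendstoD)
  then show "\<forall>\<^sub>F j in sequentially. dist (integral {-1..1} (\<lambda>t. \<phi> j t * W t)) 0 < \<epsilon>"
  proof eventually_elim
    case (elim j)
    have "norm (integral {-1..1} (\<lambda>t. \<phi> j t * W t)) \<le> integral {-1..1} (\<lambda>t. \<epsilon> / 2 * \<phi> j t)"
    proof (rule integral_norm_bound_integral)
      show "(\<lambda>t. \<phi> j t * W t) integrable_on {-1..1}" "(\<lambda>t. \<epsilon> / 2 * \<phi> j t) integrable_on {-1..1}"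
        using \<phi>(1) W(1) by (intro integrable_continuous_interval continuous_intros; simp)+
      show "norm (\<phi> j t * W t) \<le> \<epsilon> / 2 * \<phi> j t" if "t \<in> {-1..1}" for t
      proof (cases "t \<in> {a j<..<s}")
        case True
        then have "dist t s < d" using elim by (auto simp: dist_real_def)
        then have "\<bar>W t\<bar> \<le> \<epsilon> / 2" using d(2)[OF that] W(2) by (simp add: dist_real_def)
        then have "\<phi> j t * \<bar>W t\<bar> \<le> \<phi> j t * (\<epsilon> / 2)" using \<phi>(2) by (intro mult_left_mono)
        then show ?thesis using \<phi>(2) by (simp add: abs_mult mult.commute)
      qed (simp add: \<phi>(3))
    qed
    also have "\<dots> = \<epsilon> / 2" by (simp add: \<phi>(4))
    finally show ?case using \<open>0 < \<epsilon>\<close> by (simp add: dist_real_def)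
  qed
qed

text \<open>
  Squaring turns the equation into a quadratic one for the first coordinate \<open>c\<close> of a point on the
  unit circle. For \<open>s \<noteq> 0\<close> this quadratic equation is not trivial.
\<close>

lemma card_circle_line_le_2:
  fixes y1 y2 s :: real
  assumes "s \<noteq> 0"
  shows "finite {c\<in>{0..1}. c * y1 + sqrt (1 - c\<^sup>2) * y2 = s}" (is "finite ?A")
    and "card {c\<in>{0..1}. c * y1 + sqrt (1 - c\<^sup>2) * y2 = s} \<le> 2"
proof -
  define q where "q = [:s\<^sup>2 - y2\<^sup>2, - 2 * s * y1, y1\<^sup>2 + y2\<^sup>2:]"
  have q: "q \<noteq> 0"
  proof
    assume "q = 0"
    then have "y1\<^sup>2 + y2\<^sup>2 = 0" "s\<^sup>2 - y2\<^sup>2 = 0" by (simp_all add: q_def)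
    then show False using assms by (simp add: sum_power2_eq_zero_iff)
  qed
  have sub: "?A \<subseteq> {c. poly q c = 0}"
  proof
    fix c assume c: "c \<in> ?A"
    then have "c\<^sup>2 \<le> 1" by (simp add: power_le_one)
    have "s - c * y1 = sqrt (1 - c\<^sup>2) * y2" using c by auto
    then have "(s - c * y1)\<^sup>2 = (sqrt (1 - c\<^sup>2) * y2)\<^sup>2" by (rule arg_cong)
    also have "\<dots> = (1 - c\<^sup>2) * y2\<^sup>2" using \<open>c\<^sup>2 \<le> 1\<close> by (simp add: power_mult_distrib)
    finally show "c \<in> {c. poly q c = 0}"
      by (simp add: q_def power2_eq_square algebra_simps)
  qed
  show "finite ?A" using sub poly_roots_finite[OF q] by (rule finite_subset)
  have "card ?A \<le> card {c. poly q c = 0}" using sub poly_roots_finite[OF q] by (intro card_mono)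
  also have "\<dots> \<le> degree q" using q by (rule card_poly_roots_bound)
  also have "\<dots> \<le> 2" by (simp add: q_def)
  finally show "card ?A \<le> 2" .
qed

context rotation_invariant_sphere_measure
begin

lemma prob_latitude_eq:
  assumes "norm u = norm v"
  shows "prob {x. x \<bullet> u = s} = prob {x. x \<bullet> v = s}"
proof -
  obtain T where T: "orthogonal_transformation T" "T u = v"
    using exists_orthogonal_transformation_mapping[OF assms] by blast
  have meas: "T \<in> measurable P borel"
    using borel_measurable_orthogonal_transformation[OF T(1)] by (simp cong: measurable_cong_sets)
  have set: "{x. x \<bullet> v = s} \<in> sets borel"
    by (intro borel_closed closed_Collect_eq continuous_intros)
  have "T -` {x. x \<bullet> v = s} = {x. x \<bullet> u = s}"
    using T by (auto simp: orthogonal_transformation_def)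
  then have "measure (distr P borel T) {x. x \<bullet> v = s} = prob {x. x \<bullet> u = s}"
    using measure_distr[OF meas set] sets_eq_imp_space_eq[OF sets_eq_borel] by simp
  then show ?thesis by (simp add: distr_orthogonal[OF T(1)])
qed

text \<open>
  All circles of latitude at height \<open>s\<close> have the same measure, whatever their pole. If the pole runs
  over \<open>N\<close> points of a great circle, then every \<open>x\<close> lies on at most two of these circles of
  latitude, for the poles in question lie on a line in the plane of the great circle. So the common
  measure is at most \<open>2 / N\<close>.
\<close>

lemma prob_latitude_eq_0:
  fixes u e1 e2 :: 'a
  assumes u: "norm u = 1" and s: "s \<noteq> 0" and e: "norm e1 = 1" "norm e2 = 1" "e1 \<bullet> e2 = 0"
  shows "prob {x. x \<bullet> u = s} = 0"
proof (rule ccontr)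
  let ?a = "prob {x. x \<bullet> u = s}"
  assume "?a \<noteq> 0"
  then have a: "0 < ?a" using measure_nonneg[of P "{x. x \<bullet> u = s}"] by linarith
  define v where "v c = c *\<^sub>R e1 + sqrt (1 - c\<^sup>2) *\<^sub>R e2" for c
  have v: "norm (v c) = 1" if "c \<in> {0..1}" for c
  proof -
    have "e1 \<bullet> e1 = 1" "e2 \<bullet> e2 = 1" using e by (simp_all add: norm_eq_1)
    moreover have "c\<^sup>2 \<le> 1" using that by (simp add: power_le_one)
    ultimately have "v c \<bullet> v c = 1"
      using e(3) by (simp add: v_def inner_add_left inner_add_right inner_commute[of e2 e1]
          power2_eq_square[symmetric] flip: power2_eq_square)
    then show ?thesis by (simp add: norm_eq_1)
  qed
  obtain N :: nat where N: "2 < real N * ?a" using a reals_Archimedean3 by blast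
  define C where "C = (\<lambda>i::nat. 1 / real (Suc i)) ` {..<N}"
  have C: "finite C" "C \<subseteq> {0..1}" "card C = N"
    by (auto simp: C_def card_image inj_on_def)
  have meas: "{x. x \<bullet> v c = s} \<in> events" for c
    unfolding sets_eq_borel by (intro borel_closed closed_Collect_eq continuous_intros)
  have "prob {x. x \<bullet> v c = s} = ?a" if "c \<in> C" for c
    using that C(2) u v by (intro prob_latitude_eq) auto
  then have "real N * ?a = (\<Sum>c\<in>C. prob {x. x \<bullet> v c = s})"
    using C(3) by simp
  also have "\<dots> = (\<Sum>c\<in>C. \<integral>x. indicator {x. x \<bullet> v c = s} x \<partial>P)" using meas by simp
  also have "\<dots> = (\<integral>x. (\<Sum>c\<in>C. indicator {x. x \<bullet> v c = s} x) \<partial>P)"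
    using meas by (intro Bochner_Integration.integral_sum[symmetric]) (simp add: emeasure_eq_measure)
  also have "\<dots> \<le> (\<integral>x. 2 \<partial>P)"
  proof (rule integral_mono)
    fix x
    have "(\<Sum>c\<in>C. indicator {x. x \<bullet> v c = s} x) = real (card {c\<in>C. x \<bullet> v c = s})"
      using C(1) by (simp add: indicator_def sum.If_cases Int_def)
    also have "{c\<in>C. x \<bullet> v c = s} \<subseteq> {c\<in>{0..1}. c * (x \<bullet> e1) + sqrt (1 - c\<^sup>2) * (x \<bullet> e2) = s}"
      using C(2) by (auto simp: v_def inner_add_right)
    from card_mono[OF card_circle_line_le_2(1)[OF s] this]
    have "real (card {c\<in>C. x \<bullet> v c = s}) \<le> 2"
      using card_circle_line_le_2(2)[OF s, of "x \<bullet> e1" "x \<bullet> e2"] by linarith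
    finally show "(\<Sum>c\<in>C. indicator {x. x \<bullet> v c = s} x) \<le> (2::real)" .
  qed (use meas in \<open>simp_all add: emeasure_eq_measure\<close>)
  finally show False using N by (simp add: prob_space)
qed

end

context rotation_invariant_sphere_measure
begin

text \<open>
  The zonal kernels \<open>G j\<close> with derivative a bump just below \<open>s\<close> converge to the indicator of the
  cap. Their integrals against the harmonic are multiples of bump averages of
  \<open>p * (1 - t\<^sup>2) powr \<alpha>\<close>, and these converge to the value of that function at \<open>s\<close>, which is 0.
\<close>

lemma integral_cap_plane_harmonic_eq_0:
  assumes n: "2 \<le> DIM('a)" and p: "legendre_poly (DIM('a) + 2) K p" and s: "0 < s" "s < 1" "poly p s = 0"
    and e: "norm e1 = 1" "norm e2 = 1" "e1 \<bullet> e2 = 0" and u: "norm u = 1"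
  shows "(\<integral>x. indicator {x. s \<le> x \<bullet> u} x * plane_harmonic (Suc K) e1 e2 x \<partial>P) = 0"
proof -
  define \<alpha> where "\<alpha> = (real (DIM('a) + 2) - 3) / 2"
  have \<alpha>: "0 < \<alpha>" using n by (simp add: \<alpha>_def)
  let ?h = "plane_harmonic (Suc K) e1 e2"
  let ?W = "\<lambda>t. poly p t * (1 - t\<^sup>2) powr \<alpha>"
  have W: "continuous_on {-1..1} ?W" by (rule continuous_on_gegenbauer_integrand[OF \<alpha>])
  obtain \<gamma> where \<gamma>: "\<And>g. (\<integral>x. poly g (x \<bullet> u) * ?h x \<partial>P) = (\<gamma> * ?h u) * gegenbauer_integral \<alpha> (p * pderiv g)"
    using funk_hecke_poly[OF n p \<alpha>_def e] u by (auto simp: mult_ac)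
  have h1: "\<bar>?h x\<bar> \<le> 1" if "norm x = 1" for x using abs_plane_harmonic_le[OF e, of "Suc K" x] that by simp
  define a where "a j = s - s / real (Suc j)" for j
  have a: "-1 \<le> a j" "a j < s" for j
  proof -
    have "s / real (Suc j) \<le> s / 1" using s by (intro divide_left_mono) auto
    then show "-1 \<le> a j" by (simp add: a_def)
    show "a j < s" using s by (simp add: a_def)
  qed
  have alim: "a \<longlonglongrightarrow> s"
  proof -
    have "(\<lambda>j. s - s * (1 / real (Suc j))) \<longlonglongrightarrow> s - s * 0"
      by (intro tendsto_intros LIMSEQ_Suc[OF lim_1_over_n])
    then show ?thesis by (simp add: a_def[abs_def])
  qed
  have "\<forall>j. \<exists>\<phi>::real \<Rightarrow> real. continuous_on {-1..1} \<phi> \<and> (\<forall>t. 0 \<le> \<phi> t) \<and> (\<forall>t. t \<notin> {a j<..<s} \<longrightarrow> \<phi> t = 0) \<and>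
      integral {-1..1} \<phi> = 1"
    using a s by (intro allI exists_bump) auto
  then obtain \<phi> :: "nat \<Rightarrow> real \<Rightarrow> real" where \<phi>: "\<And>j. continuous_on {-1..1} (\<phi> j)" "\<And>j t. 0 \<le> \<phi> j t"
      "\<And>j t. t \<notin> {a j<..<s} \<Longrightarrow> \<phi> j t = 0" "\<And>j. integral {-1..1} (\<phi> j) = 1"
    by metis
  define G where "G j t = integral {-1..max (-1) (min 1 t)} (\<phi> j)" for j t
  have G: "0 \<le> G j t" "G j t \<le> 1" "s \<le> t \<Longrightarrow> G j t = 1" "t \<le> a j \<Longrightarrow> G j t = 0" for j t
    using integral_clamped_bump[where \<phi>="\<phi> j" and a="a j" and b=s and t=t, OF \<phi>(1) \<phi>(2) \<phi>(3) \<phi>(4)]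
      a[of j] s
    by (auto simp: G_def)
  have Gcont: "continuous_on UNIV (\<lambda>x. G j (x \<bullet> u))" for j
    unfolding G_def
    by (rule continuous_on_compose2[OF continuous_on_clamped_integral[OF \<phi>(1)]])
      (auto intro!: continuous_intros)
  have "(\<lambda>j. \<integral>x. G j (x \<bullet> u) * ?h x \<partial>P) \<longlonglongrightarrow> (\<integral>x. indicator {x. s \<le> x \<bullet> u} x * ?h x \<partial>P)"
  proof (rule integral_dominated_convergence[where w="\<lambda>_. 1"])
    have halfspace: "{x. s \<le> x \<bullet> u} \<in> sets borel"
      by (intro borel_closed closed_Collect_le continuous_intros)
    have hmeas: "?h \<in> borel_measurable borel" by (intro borel_measurable_continuous_onI continuous_intros)
    show "(\<lambda>x. indicator {x. s \<le> x \<bullet> u} x * ?h x) \<in> borel_measurable P"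
      using halfspace hmeas by (simp cong: measurable_cong_sets)
    show "(\<lambda>x. G j (x \<bullet> u) * ?h x) \<in> borel_measurable P" for j
      using borel_measurable_continuous_onI[OF Gcont] hmeas by (simp cong: measurable_cong_sets)
    show "AE x in P. (\<lambda>j. G j (x \<bullet> u) * ?h x) \<longlonglongrightarrow> indicator {x. s \<le> x \<bullet> u} x * ?h x"
    proof (rule AE_I2, rule tendsto_mult_right)
      fix x
      show "(\<lambda>j. G j (x \<bullet> u)) \<longlonglongrightarrow> indicator {x. s \<le> x \<bullet> u} x"
      proof (cases "s \<le> x \<bullet> u")
        case False
        then have "\<forall>\<^sub>F j in sequentially. x \<bullet> u < a j" by (intro order_tendstoD(1)[OF alim]) simp
        then have "\<forall>\<^sub>F j in sequentially. 0 = G j (x \<bullet> u)" by eventually_elim (simp add: G(4))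
        then show ?thesis using False by (intro Lim_transform_eventually[OF tendsto_const]) (simp add: indicator_def)
      qed (simp add: G(3))
    qed
    show "AE x in P. norm (G j (x \<bullet> u) * ?h x) \<le> 1" for j
      using AE_sphere
    proof eventually_elim
      case (elim x)
      then have "\<bar>G j (x \<bullet> u)\<bar> * \<bar>?h x\<bar> \<le> 1 * 1" using G(1,2) h1 by (intro mult_mono) auto
      then show ?case by (simp add: abs_mult)
    qed
  qed simp
  moreover have "(\<integral>x. G j (x \<bullet> u) * ?h x \<partial>P) = (\<gamma> * ?h u) * integral {-1..1} (\<lambda>t. \<phi> j t * ?W t)" for j
    unfolding G_def
    by (rule funk_hecke_continuous[OF \<phi>(1) u \<alpha> _ h1 \<gamma>]) (intro continuous_intros)
  moreover have "(\<lambda>j. (\<gamma> * ?h u) * integral {-1..1} (\<lambda>t. \<phi> j t * ?W t)) \<longlonglongrightarrow> (\<gamma> * ?h u) * 0"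
    using s by (intro tendsto_mult_left integral_bump_mult_tendsto_0[OF W _ _ alim a(1) \<phi>]) auto
  ultimately show ?thesis using LIMSEQ_unique by fastforce
qed

end

section \<open>A derandomized law of large numbers\<close>

text \<open>
  Point \<open>N\<close> is selected in view of the earlier points only. The functions \<open>h m\<close> with \<open>m \<ge> N\<close> are
  still ignored at this stage, so that every condition is a finite sum.
\<close>

lemma greedy_sequence:
  fixes h :: "nat \<Rightarrow> 'a \<Rightarrow> real" and w :: "nat \<Rightarrow> real"
  assumes "\<And>a N. \<exists>y\<in>S. (\<Sum>m<N. a m * h m y) \<le> 0"
  shows "\<exists>x. \<forall>N. x N \<in> S \<and> (\<Sum>m<N. w m * (\<Sum>j\<in>{m<..<N}. h m (x j)) * h m (x N)) \<le> 0"
proof (rule dependent_wf_choice[of less_than])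
  show "(r \<in> S \<and> (\<Sum>m<N. w m * (\<Sum>j\<in>{m<..<N}. h m (f j)) * h m r) \<le> 0) =
        (r \<in> S \<and> (\<Sum>m<N. w m * (\<Sum>j\<in>{m<..<N}. h m (g j)) * h m r) \<le> 0)"
    if "\<And>z. (z, N) \<in> less_than \<Longrightarrow> f z = g z" for f g N r
  proof -
    have "(\<Sum>j\<in>{m<..<N}. h m (f j)) = (\<Sum>j\<in>{m<..<N}. h m (g j))" for m
      using that by (intro sum.cong) auto
    then show ?thesis by simp
  qed
qed (use assms in \<open>auto simp: Bex_def\<close>)

text \<open>
  Expanding the squares, the mixed terms are nonpositive by the greedy choice, and the new squares
  contribute at most \<open>\<Sum>m. (1/2) ^ m = 2\<close>. A function \<open>h m\<close> counts only from index \<open>m + 1\<close> on, so a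
  newly admitted function starts with discrepancy 0.
\<close>

lemma greedy_potential_bound:
  fixes h :: "nat \<Rightarrow> 'a \<Rightarrow> real"
  assumes bound: "\<And>m y. \<bar>h m y\<bar> \<le> 1"
    and greedy: "\<And>N. (\<Sum>m<N. (1/2)^m * (\<Sum>j\<in>{m<..<N}. h m (x j)) * h m (x N)) \<le> 0"
  shows "(\<Sum>m<N. (1/2)^m * (\<Sum>j\<in>{m<..<N}. h m (x j))\<^sup>2) \<le> 2 * real N"
proof (induction N)
  case (Suc N)
  let ?D = "\<lambda>m N. \<Sum>j\<in>{m<..<N}. h m (x j)"
  have step: "?D m (Suc N) = ?D m N + h m (x N)" if "m < N" for m
  proof -
    have "{m<..<Suc N} = insert N {m<..<N}" using that by auto
    then show ?thesis by simp
  qed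
  have "{N<..<Suc N} = {}" by auto
  then have "(\<Sum>m<Suc N. (1/2)^m * (?D m (Suc N))\<^sup>2) = (\<Sum>m<N. (1/2)^m * (?D m (Suc N))\<^sup>2)"
    by simp
  also have "\<dots> = (\<Sum>m<N. (1/2)^m * (?D m N)\<^sup>2) + 2 * (\<Sum>m<N. (1/2)^m * ?D m N * h m (x N))
      + (\<Sum>m<N. (1/2)^m * (h m (x N))\<^sup>2)"
    unfolding sum_distrib_left[of 2] sum.distrib[symmetric]
    by (intro sum.cong refl) (simp add: step power2_sum distrib_left mult_ac)
  also have "\<dots> \<le> 2 * real N + 0 + 2"
  proof (intro add_mono)
    show "2 * (\<Sum>m<N. (1/2)^m * ?D m N * h m (x N)) \<le> 0" using greedy[of N] by linarith
    have "(\<Sum>m<N. (1/2)^m * (h m (x N))\<^sup>2) \<le> (\<Sum>m<N. (1/2::real)^m * 1)"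
      by (intro sum_mono mult_left_mono) (auto simp: abs_square_le_1 bound)
    also have "\<dots> \<le> 2" by (simp add: geometric_sum)
    finally show "(\<Sum>m<N. (1/2)^m * (h m (x N))\<^sup>2) \<le> 2" .
  qed (rule Suc)
  finally show ?case by simp
qed simp

text \<open>
  By the bound on the potential, the square of the discrepancy of \<open>h m\<close> is at most \<open>2 ^ m\<close> times a
  linear function of \<open>N\<close>, so the discrepancy is of order \<open>sqrt N\<close>. The first \<open>m\<close> terms, which the
  potential does not see, add at most \<open>m\<close>.
\<close>

lemma greedy_means_tendsto_0:
  fixes h :: "nat \<Rightarrow> 'a \<Rightarrow> real"
  assumes bound: "\<And>m y. \<bar>h m y\<bar> \<le> 1"
    and greedy: "\<And>N. (\<Sum>m<N. (1/2)^m * (\<Sum>j\<in>{m<..<N}. h m (x j)) * h m (x N)) \<le> 0"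
  shows "(\<lambda>N. 1 / real N * (\<Sum>j=1..N. h m (x j))) \<longlonglongrightarrow> 0"
proof (rule Lim_null_comparison)
  let ?D = "\<lambda>N. \<Sum>j\<in>{m<..<N}. h m (x j)"
  let ?B = "\<lambda>N. 1 / real N * (real m + sqrt (2 ^ Suc m * real (Suc N)))"
  show "\<forall>\<^sub>F N in sequentially. norm (1 / real N * (\<Sum>j=1..N. h m (x j))) \<le> ?B N"
  proof (rule eventually_sequentiallyI[of m])
    fix N assume N: "m \<le> N"
    have "(1/2)^m * (?D (Suc N))\<^sup>2 \<le> (\<Sum>m<Suc N. (1/2)^m * (\<Sum>j\<in>{m<..<Suc N}. h m (x j))\<^sup>2)"
      using N by (intro member_le_sum[of m _ "\<lambda>m. (1/2)^m * (\<Sum>j\<in>{m<..<Suc N}. h m (x j))\<^sup>2"]) auto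
    also have "\<dots> \<le> 2 * real (Suc N)" using assms by (rule greedy_potential_bound)
    finally have "(?D (Suc N))\<^sup>2 \<le> 2 ^ Suc m * real (Suc N)"
      by (simp add: power_divide field_simps)
    then have D: "\<bar>?D (Suc N)\<bar> \<le> sqrt (2 ^ Suc m * real (Suc N))"
      using real_le_rsqrt by (metis power2_abs)
    have "\<bar>\<Sum>j=1..m. h m (x j)\<bar> \<le> (\<Sum>j=1..m. \<bar>h m (x j)\<bar>)" by (rule sum_abs)
    also have "\<dots> \<le> (\<Sum>j=1..m. 1)" by (intro sum_mono bound)
    finally have init: "\<bar>\<Sum>j=1..m. h m (x j)\<bar> \<le> real m" by simp
    have "{1..N} = {1..m} \<union> {m<..<Suc N}" using N by auto
    then have "(\<Sum>j=1..N. h m (x j)) = (\<Sum>j=1..m. h m (x j)) + ?D (Suc N)"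
      by (simp add: sum.union_disjoint disjoint_iff)
    then have "\<bar>\<Sum>j=1..N. h m (x j)\<bar> \<le> real m + sqrt (2 ^ Suc m * real (Suc N))"
      using D init by linarith
    then show "norm (1 / real N * (\<Sum>j=1..N. h m (x j))) \<le> ?B N"
      by (simp add: abs_mult divide_right_mono)
  qed
  show "?B \<longlonglongrightarrow> 0" by real_asymp
qed

lemma (in prob_space) exists_le_expectation:
  fixes F :: "'a \<Rightarrow> real"
  assumes "integrable M F" "AE x in M. x \<in> S"
  shows "\<exists>x\<in>S. F x \<le> expectation F"
proof (rule ccontr)
  assume "\<not> ?thesis"
  then have "\<And>x. x \<in> S \<Longrightarrow> expectation F < F x" by (simp add: not_le)
  with assms(2) have "AE x in M. expectation F < F x" by auto
  then have "expectation (\<lambda>x. expectation F) < expectation F"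
    using assms(1) by (intro integral_less_AE_space) (auto simp: emeasure_space_1)
  then show False by (simp add: prob_space)
qed

text \<open>
  The greedy choice is possible because the centered indicators have expectation 0: so has every
  linear combination, which must be nonpositive somewhere. The enumeration includes the empty set
  only to be total when the family is empty.
\<close>

theorem (in prob_space) derandomized_law_of_large_numbers:
  assumes count: "countable \<A>" and meas: "\<A> \<subseteq> events" and S: "AE x in M. x \<in> S"
  shows "\<exists>x::nat \<Rightarrow> 'a. (\<forall>j. x j \<in> S) \<and>
    (\<forall>A\<in>\<A>. (\<lambda>N. 1 / real N * (\<Sum>j=1..N. indicator A (x j))) \<longlonglongrightarrow> prob A)"
proof -
  define e where "e m = from_nat_into (insert {} \<A>) m" for m
  have e: "e m \<in> events" for m
    using from_nat_into[of "insert {} \<A>" m] meas by (auto simp: e_def)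
  have rangee: "range e = insert {} \<A>"
    unfolding e_def using count by (simp add: range_from_nat_into)
  define h where "h m x = indicator (e m) x - prob (e m)" for m x
  have bound: "\<bar>h m x\<bar> \<le> 1" for m x
    using prob_le_1[of "e m"] measure_nonneg[of M "e m"] by (auto simp: h_def indicator_def)
  have int: "integrable M (h m)" for m
    unfolding h_def using e by (simp add: emeasure_eq_measure)
  have zero: "expectation (h m) = 0" for m
    unfolding h_def using e by (simp add: emeasure_eq_measure prob_space)
  have "\<exists>y\<in>S. (\<Sum>m<N. a m * h m y) \<le> 0" for a N
    using exists_le_expectation[of "\<lambda>y. \<Sum>m<N. a m * h m y", OF _ S] int by (simp add: zero)
  from greedy_sequence[of S h "\<lambda>m. (1/2)^m", OF this]
  obtain x where x: "\<And>N. x N \<in> S"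
      "\<And>N. (\<Sum>m<N. (1/2)^m * (\<Sum>j\<in>{m<..<N}. h m (x j)) * h m (x N)) \<le> 0"
    by auto
  have "(\<lambda>N. 1 / real N * (\<Sum>j=1..N. indicator (e m) (x j))) \<longlonglongrightarrow> prob (e m)" for m
  proof -
    have "(\<lambda>N. 1 / real N * (\<Sum>j=1..N. h m (x j)) + prob (e m)) \<longlonglongrightarrow> 0 + prob (e m)"
      using bound x(2) by (intro tendsto_add tendsto_const greedy_means_tendsto_0)
    then have "(\<lambda>N. 1 / real N * (\<Sum>j=1..N. h m (x j)) + prob (e m)) \<longlonglongrightarrow> prob (e m)" by simp
    then show ?thesis
    proof (rule Lim_transform_eventually)
      show "\<forall>\<^sub>F N in sequentially. 1 / real N * (\<Sum>j=1..N. h m (x j)) + prob (e m) =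
          1 / real N * (\<Sum>j=1..N. indicator (e m) (x j))"
        by (rule eventually_sequentiallyI[of 1]) (simp add: h_def sum_subtractf field_simps)
    qed
  qed
  then have "\<forall>A\<in>range e. (\<lambda>N. 1 / real N * (\<Sum>j=1..N. indicator A (x j))) \<longlonglongrightarrow> prob A" by blast
  with x(1) show ?thesis unfolding rangee by blast
qed

section \<open>Frequencies of caps\<close>

lemma tendsto_squeezed_by_sequences:
  fixes a :: "nat \<Rightarrow> real"
  assumes "\<And>\<epsilon>. 0 < \<epsilon> \<Longrightarrow> \<exists>b c lb lc. b \<longlonglongrightarrow> lb \<and> c \<longlonglongrightarrow> lc \<and> (\<forall>N. b N \<le> a N \<and> a N \<le> c N) \<and>
    l - \<epsilon> \<le> lb \<and> lc \<le> l + \<epsilon>"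
  shows "a \<longlonglongrightarrow> l"
proof (rule order_tendstoI)
  fix y assume "y < l"
  then obtain b lb where b: "b \<longlonglongrightarrow> lb" "\<And>N. b N \<le> a N" "l - (l - y) / 2 \<le> lb"
    using assms[of "(l - y) / 2"] by auto
  have "y < lb" using b(3) \<open>y < l\<close> by (simp add: field_simps)
  from order_tendstoD(1)[OF b(1) this] show "\<forall>\<^sub>F N in sequentially. y < a N"
    by eventually_elim (use b(2) in \<open>auto intro: less_le_trans\<close>)
next
  fix y assume "l < y"
  then obtain c lc where c: "c \<longlonglongrightarrow> lc" "\<And>N. a N \<le> c N" "lc \<le> l + (y - l) / 2"
    using assms[of "(y - l) / 2"] by auto
  have "lc < y" using c(3) \<open>l < y\<close> by (simp add: field_simps)
  from order_tendstoD(2)[OF c(1) this] show "\<forall>\<^sub>F N in sequentially. a N < y"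
    by eventually_elim (use c(2) in \<open>auto intro: le_less_trans\<close>)
qed

lemma sets_spherical_cap [measurable]: "spherical_cap s w \<in> sets borel"
proof -
  have "spherical_cap s w = sphere 0 1 \<inter> {x. s \<le> w \<bullet> x}" by (auto simp: spherical_cap_def)
  then show ?thesis by (simp add: closed_halfspace_ge borel_closed closed_Int)
qed

lemma spherical_cap_antimono: "r \<le> s \<Longrightarrow> spherical_cap s w \<subseteq> spherical_cap r w"
  by (auto simp: spherical_cap_def)

lemma spherical_cap_perturb:
  assumes "norm (v - w) \<le> d" "s + d \<le> t"
  shows "spherical_cap t v \<subseteq> spherical_cap s w"
proof
  fix x assume x: "x \<in> spherical_cap t v"
  have "\<bar>(v - w) \<bullet> x\<bar> \<le> norm (v - w) * norm x" by (rule Cauchy_Schwarz_ineq2)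
  then show "x \<in> spherical_cap s w"
    using x assms by (auto simp: spherical_cap_def inner_diff_left)
qed

text \<open>
  The caps of height slightly below \<open>s\<close> decrease to the cap of height \<open>s\<close>. Those of height slightly
  above \<open>s\<close> exhaust it only up to its boundary circle, which therefore has to be a null set.
\<close>

lemma spherical_cap_continuity:
  fixes M :: "'a::euclidean_space measure"
  assumes M: "prob_space M" and sets [measurable_cong]: "sets M = sets borel" and null: "measure M {x. w \<bullet> x = s} = 0" and \<epsilon>: "0 < \<epsilon>"
  shows "\<exists>\<eta>>0. measure M (spherical_cap (s - \<eta>) w) \<le> measure M (spherical_cap s w) + \<epsilon> \<and>
    measure M (spherical_cap s w) - \<epsilon> \<le> measure M (spherical_cap (s + \<eta>) w)"
proof -
  interpret prob_space M by (rule M)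
  let ?r = "\<lambda>j. 1 / real (Suc j)"
  have r: "?r \<longlonglongrightarrow> 0" by (rule LIMSEQ_Suc[OF lim_1_over_n])
  have r_mono: "?r j \<le> ?r i" if "i \<le> j" for i j using that by (simp add: frac_le)
  have cap: "spherical_cap t w \<in> events" for t by (simp add: sets sets_spherical_cap)
  have "(\<lambda>j. measure M (spherical_cap (s - ?r j) w)) \<longlonglongrightarrow> measure M (\<Inter>j. spherical_cap (s - ?r j) w)"
    by (rule finite_Lim_measure_decseq)
      (auto intro!: cap decseq_SucI spherical_cap_antimono simp: frac_le)
  also have "(\<Inter>j. spherical_cap (s - ?r j) w) = spherical_cap s w"
  proof -
    have "s \<le> t" if "\<And>j. s - ?r j \<le> t" for t
    proof (rule LIMSEQ_le_const2)
      show "(\<lambda>j. s - ?r j) \<longlonglongrightarrow> s" using tendsto_diff[OF tendsto_const r] by simp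
    qed (use that in auto)
    moreover have "s - ?r j \<le> t" if "s \<le> t" for t j
    proof -
      have "0 \<le> ?r j" by simp
      then show ?thesis using that by linarith
    qed
    ultimately show ?thesis unfolding spherical_cap_def by blast
  qed
  finally have 1: "\<forall>\<^sub>F j in sequentially. measure M (spherical_cap (s - ?r j) w) < measure M (spherical_cap s w) + \<epsilon>"
    using \<epsilon> by (intro order_tendstoD) auto
  have "(\<lambda>j. measure M (spherical_cap (s + ?r j) w)) \<longlonglongrightarrow> measure M (\<Union>j. spherical_cap (s + ?r j) w)"
    by (rule finite_Lim_measure_incseq)
      (auto intro!: cap incseq_SucI spherical_cap_antimono simp: frac_le)
  moreover have "measure M (spherical_cap s w) \<le> measure M (\<Union>j. spherical_cap (s + ?r j) w)"
  proof (rule finite_measure_mono_AE)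
    have "{x. w \<bullet> x = s} \<in> events"
      unfolding sets by (intro borel_closed closed_Collect_eq continuous_intros)
    then have "AE x in M. w \<bullet> x \<noteq> s"
      using null by (intro AE_I[of _ _ "{x. w \<bullet> x = s}"]) (auto simp: emeasure_eq_measure)
    then show "AE x in M. x \<in> spherical_cap s w \<longrightarrow> x \<in> (\<Union>j. spherical_cap (s + ?r j) w)"
    proof eventually_elim
      case (elim x)
      show ?case
      proof
        assume x: "x \<in> spherical_cap s w"
        then have "0 < w \<bullet> x - s" using elim by (auto simp: spherical_cap_def)
        then obtain j where "?r j < w \<bullet> x - s" by (metis nat_approx_posE)
        then show "x \<in> (\<Union>j. spherical_cap (s + ?r j) w)"
          using x by (auto simp: spherical_cap_def intro!: exI[of _ j])
      qed
    qed
  qed (auto intro!: cap)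
  ultimately have 2: "\<forall>\<^sub>F j in sequentially. measure M (spherical_cap s w) - \<epsilon> < measure M (spherical_cap (s + ?r j) w)"
    using \<epsilon> by (intro order_tendstoD) auto
  obtain j where "measure M (spherical_cap (s - ?r j) w) < measure M (spherical_cap s w) + \<epsilon>"
      "measure M (spherical_cap s w) - \<epsilon> < measure M (spherical_cap (s + ?r j) w)"
    using eventually_happens'[OF trivial_limit_sequentially eventually_conj[OF 1 2]] by auto
  then show ?thesis by (intro exI[of _ "?r j"]) auto
qed

text \<open>
  Every cap can be squeezed between two caps of the countable family, one slightly lower and one
  slightly higher, with almost the same measure.
\<close>

lemma spherical_cap_frequencies_from_dense:
  fixes M :: "'a::euclidean_space measure" and u :: "nat \<Rightarrow> 'a"
  assumes M: "prob_space M" and sets: "sets M = sets borel" and null: "measure M {x. w \<bullet> x = s} = 0"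
    and dense: "\<And>X. open X \<Longrightarrow> X \<noteq> {} \<Longrightarrow> \<exists>v\<in>D. v \<in> X"
    and conv: "\<And>t v. t \<in> \<rat> \<Longrightarrow> v \<in> D \<Longrightarrow>
      (\<lambda>N. 1 / real N * (\<Sum>j=1..N. indicator (spherical_cap t v) (u j))) \<longlonglongrightarrow> measure M (spherical_cap t v)"
  shows "(\<lambda>N. 1 / real N * (\<Sum>j=1..N. indicator (spherical_cap s w) (u j))) \<longlonglongrightarrow> measure M (spherical_cap s w)"
proof (rule tendsto_squeezed_by_sequences)
  interpret prob_space M by (rule M)
  fix \<epsilon> :: real assume "0 < \<epsilon>"
  let ?freq = "\<lambda>A N. 1 / real N * (\<Sum>j=1..N. indicator A (u j)) :: real"
  obtain \<eta> where \<eta>: "0 < \<eta>" "measure M (spherical_cap (s - \<eta>) w) \<le> measure M (spherical_cap s w) + \<epsilon>"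
      "measure M (spherical_cap s w) - \<epsilon> \<le> measure M (spherical_cap (s + \<eta>) w)"
    using spherical_cap_continuity[OF M sets null \<open>0 < \<epsilon>\<close>] by blast
  have cap: "spherical_cap t v \<in> events" for t and v :: 'a by (simp add: sets sets_spherical_cap)
  obtain v where v: "v \<in> D" "v \<in> ball w (\<eta> / 4)" using dense[of "ball w (\<eta> / 4)"] \<eta> by auto
  then have vw: "norm (v - w) \<le> \<eta> / 4" "norm (w - v) \<le> \<eta> / 4" by (auto simp: dist_norm norm_minus_commute)
  \<comment> \<open>Moving the center by at most \<open>\<eta> / 4\<close> changes heights by at most \<open>\<eta> / 4\<close>, so these
    heights keep the caps around \<open>v\<close> between the caps of heights \<open>s - \<eta>\<close>, \<open>s\<close> and \<open>s + \<eta>\<close>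
    around \<open>w\<close>.\<close>
  obtain t1 where t1: "t1 \<in> \<rat>" "s + \<eta> / 4 < t1" "t1 < s + \<eta> / 2"
    using Rats_dense_in_real[of "s + \<eta> / 4" "s + \<eta> / 2"] \<eta> by auto
  obtain t2 where t2: "t2 \<in> \<rat>" "s - \<eta> / 2 < t2" "t2 < s - \<eta> / 4"
    using Rats_dense_in_real[of "s - \<eta> / 2" "s - \<eta> / 4"] \<eta> by auto
  have sub: "spherical_cap t1 v \<subseteq> spherical_cap s w" "spherical_cap s w \<subseteq> spherical_cap t2 v"
      "spherical_cap (s + \<eta>) w \<subseteq> spherical_cap t1 v" "spherical_cap t2 v \<subseteq> spherical_cap (s - \<eta>) w"
    using t1 t2 \<eta>(1)
    by (simp_all add: spherical_cap_perturb[OF vw(1)] spherical_cap_perturb[OF vw(2)])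
  have freq_mono: "?freq A N \<le> ?freq B N" if "A \<subseteq> B" for A B N
    using that by (intro mult_left_mono sum_mono) (auto simp: indicator_def)
  show "\<exists>b c lb lc. b \<longlonglongrightarrow> lb \<and> c \<longlonglongrightarrow> lc \<and> (\<forall>N. b N \<le> ?freq (spherical_cap s w) N \<and> ?freq (spherical_cap s w) N \<le> c N) \<and>
      measure M (spherical_cap s w) - \<epsilon> \<le> lb \<and> lc \<le> measure M (spherical_cap s w) + \<epsilon>"
  proof (intro exI conjI allI)
    show "?freq (spherical_cap t1 v) \<longlonglongrightarrow> measure M (spherical_cap t1 v)" by (rule conv[OF t1(1) v(1)])
    show "?freq (spherical_cap t2 v) \<longlonglongrightarrow> measure M (spherical_cap t2 v)" by (rule conv[OF t2(1) v(1)])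
    show "measure M (spherical_cap s w) - \<epsilon> \<le> measure M (spherical_cap t1 v)"
      using \<eta>(3) finite_measure_mono[OF sub(3) cap] by linarith
    show "measure M (spherical_cap t2 v) \<le> measure M (spherical_cap s w) + \<epsilon>"
      using \<eta>(2) finite_measure_mono[OF sub(4) cap] by linarith
  qed (intro freq_mono sub)+
qed

section \<open>A non-uniform density invisible to the caps\<close>

lemma exists_orthonormal_pair:
  assumes "2 \<le> DIM('a::euclidean_space)"
  shows "\<exists>e1 e2::'a. norm e1 = 1 \<and> norm e2 = 1 \<and> e1 \<bullet> e2 = 0"
proof -
  obtain e1 :: 'a where e1: "e1 \<in> Basis" using nonempty_Basis by blast
  have "card (Basis - {e1}) \<noteq> 0" using assms e1 by simp
  then obtain e2 where "e2 \<in> Basis - {e1}" by (metis card.empty ex_in_conv)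
  then show ?thesis using e1 by (intro exI[of _ e1] exI[of _ e2]) (auto simp: inner_not_same_Basis)
qed

lemma frontier_of_superlevel_set:
  fixes h :: "'a::topological_space \<Rightarrow> real"
  assumes "continuous_on S h"
  shows "top_of_set S frontier_of {x\<in>S. c \<le> h x} \<subseteq> {x\<in>S. h x = c}"
proof -
  have "closedin (top_of_set S) (S \<inter> h -` {c..})"
    by (rule continuous_closedin_preimage[OF assms]) simp
  then have closed: "closedin (top_of_set S) {x\<in>S. c \<le> h x}"
    by (simp add: Int_def vimage_def)
  have "openin (top_of_set S) (S \<inter> h -` {c<..})"
    by (rule continuous_openin_preimage_gen[OF assms]) simp
  then have "S \<inter> h -` {c<..} \<subseteq> top_of_set S interior_of {x\<in>S. c \<le> h x}"
    by (intro interior_of_maximal) auto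
  then show ?thesis
    unfolding frontier_of_def closure_of_closedin[OF closed] by auto
qed

context rotation_invariant_sphere_measure
begin

lemma emeasure_density_eq_integral:
  fixes g :: "'a \<Rightarrow> real"
  assumes g: "continuous_on UNIV g" "\<And>x. norm x = 1 \<Longrightarrow> 0 \<le> g x" and A: "A \<in> sets borel"
  shows "emeasure (density P (\<lambda>x. ennreal (g x))) A = ennreal (\<integral>x. indicator A x * g x \<partial>P)"
    and "integrable P (\<lambda>x. indicator A x * g x)" and "0 \<le> (\<integral>x. indicator A x * g x \<partial>P)"
proof -
  have meas: "g \<in> borel_measurable P"
    using borel_measurable_continuous_onI[OF g(1)] by (simp cong: measurable_cong_sets)
  show int: "integrable P (\<lambda>x. indicator A x * g x)"
    using integrable_mult_indicator[OF _ integrable_continuous[OF g(1)], of A] A by simp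
  have nonneg: "AE x in P. 0 \<le> indicator A x * g x"
    using AE_sphere by eventually_elim (use g(2) in \<open>auto simp: indicator_def\<close>)
  then show "0 \<le> (\<integral>x. indicator A x * g x \<partial>P)" by (rule integral_nonneg_AE)
  have "emeasure (density P (\<lambda>x. ennreal (g x))) A = (\<integral>\<^sup>+x. ennreal (g x) * indicator A x \<partial>P)"
    using meas A by (intro emeasure_density) auto
  also have "\<dots> = (\<integral>\<^sup>+x. ennreal (indicator A x * g x) \<partial>P)"
    by (intro nn_integral_cong) (auto simp: indicator_def)
  also have "\<dots> = ennreal (\<integral>x. indicator A x * g x \<partial>P)"
    by (rule nn_integral_eq_integral[OF int nonneg])
  finally show "emeasure (density P (\<lambda>x. ennreal (g x))) A = ennreal (\<integral>x. indicator A x * g x \<partial>P)" .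
qed

text \<open>
  A function with mean 0 that does not vanish almost everywhere is positive with positive
  probability, hence exceeds some positive level with positive probability; only countably many
  levels are atoms of its distribution.
\<close>

lemma exists_level_with_null_boundary:
  fixes h :: "'a \<Rightarrow> real"
  assumes h: "continuous_on UNIV h" and zero: "(\<integral>x. h x \<partial>P) = 0" and nonzero: "\<not> (AE x in P. h x = 0)"
  shows "\<exists>\<delta>>0. 0 < prob {x. \<delta> \<le> h x} \<and> prob {x. h x = \<delta>} = 0"
proof -
  have hmeas [measurable]: "h \<in> borel_measurable borel" by (rule borel_measurable_continuous_onI[OF h])
  then have hP [measurable]: "h \<in> borel_measurable P" by (simp cong: measurable_cong_sets)
  have level: "{x. c \<le> h x} \<in> events" for c by (simp add: sets_eq_borel)
  have int: "integrable P h" by (rule integrable_continuous[OF h])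
  have "\<exists>j. prob {x. 1 / real (Suc j) \<le> h x} \<noteq> 0"
  proof (rule ccontr)
    assume "\<not> ?thesis"
    then have "AE x in P. x \<notin> {x. 1 / real (Suc j) \<le> h x}" for j
      using level by (intro AE_not_in null_setsI) (auto simp: emeasure_eq_measure)
    then have "AE x in P. \<forall>j. h x < 1 / real (Suc j)" by (simp add: AE_all_countable not_le)
    then have le: "AE x in P. 0 \<le> - h x"
    proof eventually_elim
      case (elim x)
      show ?case
      proof (rule ccontr)
        assume "\<not> 0 \<le> - h x"
        then obtain j where "1 / real (Suc j) < h x" by (metis nat_approx_posE neg_0_le_iff_le not_le)
        then show False using elim by (meson less_asym)
      qed
    qed
    have "(\<integral>x. - h x \<partial>P) = 0" using zero by simp
    then have "AE x in P. - h x = 0"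
      using integral_nonneg_eq_0_iff_AE[OF _ le] int by simp
    then show False using nonzero by simp
  qed
  then obtain \<delta>0 where \<delta>0: "0 < \<delta>0" "prob {x. \<delta>0 \<le> h x} \<noteq> 0" by (metis zero_less_divide_1_iff of_nat_0_less_iff zero_less_Suc)
  interpret D: prob_space "distr P borel h" using hP by (rule prob_space_distr)
  have "uncountable {0<..<\<delta>0}" using \<delta>0 by (simp add: uncountable_open_interval)
  then have "\<not> {0<..<\<delta>0} \<subseteq> {t. D.prob {t} \<noteq> 0}" using D.countable_support countable_subset by blast
  then obtain \<delta> where \<delta>: "0 < \<delta>" "\<delta> < \<delta>0" "D.prob {\<delta>} = 0" by auto
  have "D.prob {\<delta>} = prob (h -` {\<delta>} \<inter> space P)" by (intro measure_distr hP) simp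
  also have "h -` {\<delta>} \<inter> space P = {x. h x = \<delta>}"
    using sets_eq_imp_space_eq[OF sets_eq_borel] by auto
  finally have "prob {x. h x = \<delta>} = 0" using \<delta>(3) by simp
  moreover have "prob {x. \<delta>0 \<le> h x} \<le> prob {x. \<delta> \<le> h x}"
    using \<delta>(2) by (intro finite_measure_mono level) auto
  then have "0 < prob {x. \<delta> \<le> h x}"
    using \<delta>0(2) measure_nonneg[of P "{x. \<delta>0 \<le> h x}"] by linarith
  ultimately show ?thesis using \<delta>(1) by blast
qed

text \<open>
  The sequence follows the measure \<open>M\<close> with density \<open>1 + h\<close>. Caps of height \<open>s\<close> have the same mass
  under \<open>M\<close> and \<open>P\<close>, whereas \<open>M\<close> gives the superlevel set \<open>A\<close> of \<open>h\<close> more mass than \<open>P\<close> does.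
\<close>

theorem exists_sequence_with_correct_cap_frequencies:
  assumes n: "2 \<le> DIM('a)" and s: "s \<in> even_legendre_zeros (DIM('a) + 2)"
  shows "\<exists>(u :: nat \<Rightarrow> 'a) A. (\<forall>j. u j \<in> sphere 0 1) \<and>
    (\<forall>w\<in>sphere 0 1. (\<lambda>N. 1 / real N * (\<Sum>j=1..N. indicator (spherical_cap s w) (u j)))
      \<longlonglongrightarrow> prob (spherical_cap s w)) \<and>
    A \<in> sets borel \<and> A \<subseteq> sphere 0 1 \<and> prob (top_of_set (sphere 0 1) frontier_of A) = 0 \<and>
    \<not> (\<lambda>N. 1 / real N * (\<Sum>j=1..N. indicator A (u j))) \<longlonglongrightarrow> prob A"
proof -
  obtain K p where s01: "0 < s" "s < 1" and p: "legendre_poly (DIM('a) + 2) K p" "poly p s = 0"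
    using s by (auto simp: even_legendre_zeros_def)
  obtain e1 e2 :: 'a where e: "norm e1 = 1" "norm e2 = 1" "e1 \<bullet> e2 = 0"
    using exists_orthonormal_pair[OF n] by blast
  define h where "h = plane_harmonic (Suc K) e1 e2"
  have hcont: "continuous_on S h" for S unfolding h_def by (intro continuous_intros)
  have hmeas [measurable]: "h \<in> borel_measurable borel" by (rule borel_measurable_continuous_onI[OF hcont])
  have h1: "\<bar>h x\<bar> \<le> 1" if "norm x = 1" for x
    using abs_plane_harmonic_le[OF e, of "Suc K" x] that by (simp add: h_def)
  have hint: "integrable P h" by (rule integrable_continuous[OF hcont])
  have hzero: "(\<integral>x. h x \<partial>P) = 0"
    using funk_hecke_monomial_Re[OF e(1) e, of 0 "Suc K"] by (simp add: h_def funk_hecke_factor_less)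
  have hnonzero: "\<not> (AE x in P. h x = 0)"
  proof
    assume "AE x in P. h x = 0"
    then have "AE x in P. (x \<bullet> e1) ^ Suc K * h x = 0" by eventually_elim simp
    then have "(\<integral>x. (x \<bullet> e1) ^ Suc K * h x \<partial>P) = 0" by (simp add: integral_eq_zero_AE)
    moreover have "h e1 = 1"
      using e by (simp add: h_def plane_harmonic_def plane_coord_def norm_eq_1 complex_eq_iff
          flip: one_complex.code)
    ultimately show False
      using funk_hecke_monomial_Re[OF e(1) e, of "Suc K" "Suc K"] funk_hecke_factor_diag_pos[of "Suc K"]
      by (simp add: h_def)
  qed
  obtain \<delta> where \<delta>: "0 < \<delta>" "0 < prob {x. \<delta> \<le> h x}" "prob {x. h x = \<delta>} = 0"
    using exists_level_with_null_boundary[OF hcont hzero hnonzero] by blast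
  define A where "A = {x\<in>sphere 0 1. \<delta> \<le> h x}"
  have A: "A \<in> sets borel" "A \<subseteq> sphere 0 1" unfolding A_def by (auto, measurable)
  define M where "M = density P (\<lambda>x. ennreal (1 + h x))"
  have sets_M: "sets M = sets borel" by (simp add: M_def)
  have "0 \<le> 1 + h x" if "norm x = 1" for x using h1[OF that] by linarith
  moreover have "continuous_on UNIV (\<lambda>x. 1 + h x)" by (intro continuous_intros hcont)
  ultimately have dens: "continuous_on UNIV (\<lambda>x. 1 + h x)" "\<And>x. norm x = 1 \<Longrightarrow> 0 \<le> 1 + h x" by auto
  have M: "measure M B = prob B + (\<integral>x. indicator B x * h x \<partial>P)" if B: "B \<in> sets borel" for B
  proof -
    have "measure M B = (\<integral>x. indicator B x * (1 + h x) \<partial>P)"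
      using emeasure_density_eq_integral(1,3)[OF dens B] by (simp add: measure_def M_def)
    also have "\<dots> = (\<integral>x. indicator B x + indicator B x * h x \<partial>P)" by (simp add: distrib_left)
    also have "\<dots> = prob B + (\<integral>x. indicator B x * h x \<partial>P)"
      using B integrable_mult_indicator[OF _ hint, of B] by (simp add: emeasure_eq_measure)
    finally show ?thesis .
  qed
  interpret M: prob_space M
  proof
    have "emeasure M UNIV = ennreal (\<integral>x. indicator UNIV x * (1 + h x) \<partial>P)"
      unfolding M_def by (rule emeasure_density_eq_integral(1)[OF dens borel_open[OF open_UNIV]])
    also have "(\<integral>x. indicator UNIV x * (1 + h x) \<partial>P) = 1"
      using hint hzero by (simp add: prob_space)
    finally show "emeasure M (space M) = 1"
      using sets_eq_imp_space_eq[OF sets_M] by simp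
  qed
  have M_sphere: "AE x in M. x \<in> sphere 0 1"
    unfolding M_def using AE_sphere by (subst AE_density) (auto elim: eventually_mono)
  have M_null: "measure M {x. w \<bullet> x = s} = 0" if w: "norm w = 1" for w
  proof -
    let ?B = "{x. w \<bullet> x = s}"
    have B: "?B \<in> sets borel" by (intro borel_closed closed_Collect_eq continuous_intros)
    have 0: "prob ?B = 0"
      using prob_latitude_eq_0[OF w _ e, of s] s01 by (simp add: inner_commute)
    then have "AE x in P. x \<notin> ?B" using B by (intro AE_not_in null_setsI) (auto simp: emeasure_eq_measure)
    then have "AE x in P. indicator ?B x * h x = 0" by eventually_elim (simp add: indicator_def)
    then have "(\<integral>x. indicator ?B x * h x \<partial>P) = 0" by (rule integral_eq_zero_AE)
    then show ?thesis using M[OF B] 0 by simp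
  qed
  have M_cap: "measure M (spherical_cap s w) = prob (spherical_cap s w)" if w: "norm w = 1" for w
  proof -
    have "(\<integral>x. indicator (spherical_cap s w) x * h x \<partial>P) = (\<integral>x. indicator {x. s \<le> x \<bullet> w} x * h x \<partial>P)"
    proof (rule integral_cong_AE)
      show "AE x in P. indicator (spherical_cap s w) x * h x = indicator {x. s \<le> x \<bullet> w} x * h x"
        using AE_sphere by eventually_elim (auto simp: spherical_cap_def indicator_def inner_commute)
    qed (simp_all cong: measurable_cong_sets)
    also have "\<dots> = 0"
      unfolding h_def by (rule integral_cap_plane_harmonic_eq_0[OF n p(1) s01 p(2) e w])
    finally show ?thesis using M[OF sets_spherical_cap] by simp
  qed
  have M_A: "prob A < measure M A"
  proof -
    have AE_A: "prob A = prob {x. \<delta> \<le> h x}"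
      by (rule finite_measure_eq_AE) (use AE_sphere A(1) in \<open>auto simp: A_def sets_eq_borel elim: eventually_mono\<close>)
    have "\<delta> * prob A = (\<integral>x. \<delta> * indicator A x \<partial>P)" using A(1) by simp
    also have "\<dots> \<le> (\<integral>x. indicator A x * h x \<partial>P)"
    proof (rule integral_mono)
      show "integrable P (\<lambda>x. \<delta> * indicator A x)" using A(1) by (simp add: emeasure_eq_measure)
      show "integrable P (\<lambda>x. indicator A x * h x)"
        using A(1) integrable_mult_indicator[OF _ hint, of A] by simp
      show "\<delta> * indicator A x \<le> indicator A x * h x" for x by (simp add: indicator_def A_def)
    qed
    finally have "\<delta> * prob A \<le> (\<integral>x. indicator A x * h x \<partial>P)" .
    moreover have "0 < \<delta> * prob A" using \<delta> AE_A by simp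
    ultimately show ?thesis using M[OF A(1)] by linarith
  qed
  obtain D :: "'a set" where D: "countable D" "\<And>X. open X \<Longrightarrow> X \<noteq> {} \<Longrightarrow> \<exists>v\<in>D. v \<in> X"
    using countable_dense_setE by blast
  let ?\<A> = "insert A ((\<lambda>(t, v). spherical_cap t v) ` (\<rat> \<times> D))"
  have "countable ?\<A>" by (intro countable_insert countable_image countable_SIGMA countable_rat D(1))
  moreover have "?\<A> \<subseteq> M.events" using A(1) by (auto simp: sets_M sets_spherical_cap)
  ultimately obtain u where u: "\<And>j. u j \<in> sphere 0 1"
      "\<And>B. B \<in> ?\<A> \<Longrightarrow> (\<lambda>N. 1 / real N * (\<Sum>j=1..N. indicator B (u j))) \<longlonglongrightarrow> measure M B"
    using M.derandomized_law_of_large_numbers[OF _ _ M_sphere, of ?\<A>] by blast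
  have "(\<lambda>N. 1 / real N * (\<Sum>j=1..N. indicator (spherical_cap s w) (u j))) \<longlonglongrightarrow> prob (spherical_cap s w)"
    if w: "w \<in> sphere 0 1" for w
  proof -
    have w1: "norm w = 1" using w by simp
    show ?thesis unfolding M_cap[OF w1, symmetric]
      by (rule spherical_cap_frequencies_from_dense[OF M.prob_space_axioms sets_M M_null[OF w1] D(2)])
        (assumption | rule u(2), blast)+
  qed
  moreover have "\<not> (\<lambda>N. 1 / real N * (\<Sum>j=1..N. indicator A (u j))) \<longlonglongrightarrow> prob A"
  proof
    assume "(\<lambda>N. 1 / real N * (\<Sum>j=1..N. indicator A (u j))) \<longlonglongrightarrow> prob A"
    moreover have "(\<lambda>N. 1 / real N * (\<Sum>j=1..N. indicator A (u j))) \<longlonglongrightarrow> measure M A" by (rule u(2)) simp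
    ultimately have "prob A = measure M A" by (rule LIMSEQ_unique)
    then show False using M_A by simp
  qed
  moreover have "prob (top_of_set (sphere 0 1) frontier_of A) = 0"
  proof -
    have "{x. h x = \<delta>} \<in> events" by (simp add: sets_eq_borel)
    then have "prob (top_of_set (sphere 0 1) frontier_of A) \<le> prob {x. h x = \<delta>}"
      using frontier_of_superlevel_set[OF hcont, of "sphere 0 1" \<delta>]
      by (intro finite_measure_mono) (auto simp: A_def)
    then show ?thesis using \<delta>(3) measure_nonneg[of P] by (simp add: antisym)
  qed
  ultimately show ?thesis using u(1) A by blast
qed

end

theorem theorem3:
  fixes s :: real
  assumes "CARD('n::finite) \<ge> 3"
    and "s \<in> even_legendre_zeros (CARD('n) + 2)"
  shows "\<exists>u :: nat \<Rightarrow> real ^ 'n.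
           (\<forall>j\<ge>1. u j \<in> sphere 0 1) \<and>
           (\<forall>w \<in> sphere 0 1. frequencies_converge u (spherical_cap s w)) \<and>
           \<not> uniformly_distributed u"
proof -
  interpret rotation_invariant_sphere_measure "sphere_prob :: (real ^ 'n) measure"
    by (rule sphere_prob_rotation_invariant)
  have "2 \<le> DIM(real ^ 'n)" "s \<in> even_legendre_zeros (DIM(real ^ 'n) + 2)" using assms by simp_all
  from exists_sequence_with_correct_cap_frequencies[OF this]
  show ?thesis unfolding uniformly_distributed_def frequencies_converge_def by blast
qed

end
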